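(* Let $F$ be a field, let $K\leqslant \mathrm{Sym}(\Delta)$ be primitive, where $k=|\Delta|\geqslant 2$, let $\Sigma=\{1,2,\ldots,\ell\}$ with $\ell\geqslant 1$, let $L\leqslant \mathrm{Sym}(\Sigma)$, and let $G=K\wr L$ act on $\Omega=\Delta\times\Sigma$ in its imprimitive action. Then $$\mathrm{LinDim}_F(G,\Omega)=\begin{cases}\ell+1 & \text{if } K \text{ is regular and } k=\mathrm{char}(F),\\ \ell\,\mathrm{LinDim}_F(K,\Delta) & \text{otherwise.}\end{cases}$$
   Context: A representation over $F$ of an action of a group $G$ on a set $\Omega$ is a pair $(\rho,\varphi)$ where, for some $F$-vector space $V$, $\rho:G\to \mathrm{GL}(V)$ is a homomorphism and $\varphi:\Omega\to V$ is injective with $(\omega^g)\varphi=(\omega\varphi)^{g\rho}$ for all $\omega\in\Omega$, $g\in G$ (maps written on the right). $\mathrm{LinDim}_F(G,\Omega)$ is the minimum of $\dim V$ over all $V$ affording such a representation. A group is primitive on $\Delta$ if it is transitive and preserves only the trivial partitions of $\Delta$ (one part, or all singletons); it is regular if it is transitive with trivial point stabilisers. The wreath product is $K\wr L=K^\ell\rtimes L$ with $(h_1,\ldots,h_\ell)^\sigma=(h_{1\sigma^{-1}},\ldots,h_{\ell\sigma^{-1}})$ for $\sigma\in L$; its imprimitive action on $\Delta\times\Sigma$ is $(\delta,i)^{(h_1,\ldots,h_\ell)\sigma}=(\delta^{h_i},i^\sigma)$. *)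

theory Defs
  imports
    Complex_Main
    "HOL-Algebra.Product_Groups"
    "HOL-Combinatorics.Permutations"
    "HOL-Library.Disjoint_Sets"
    "HOL-Library.Function_Algebras"
begin

unbundle cardinal_syntax

text \<open>
  Maps are written on the right in the mathematics: the product of the permutations \<open>f\<close> and \<open>g\<close>
  is ``first \<open>f\<close>, then \<open>g\<close>''. Permutations of \<open>S\<close> are total functions that are the
  identity outside \<open>S\<close>, and a permutation group on \<open>S\<close> is a subgroup of \<open>Sym S\<close>, given by its
  carrier.
\<close>

definition Sym :: "'a set \<Rightarrow> ('a \<Rightarrow> 'a) monoid" where
  "Sym S = \<lparr>carrier = {f. f permutes S}, monoid.mult = (\<lambda>f g. g \<circ> f), one = id\<rparr>"

abbreviation perm_group :: "'a set \<Rightarrow> ('a \<Rightarrow> 'a) set \<Rightarrow> ('a \<Rightarrow> 'a) monoid" where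
  "perm_group S K \<equiv> Sym S\<lparr>carrier := K\<rparr>"

definition transitive_on :: "'a set \<Rightarrow> ('a \<Rightarrow> 'a) set \<Rightarrow> bool" where
  "transitive_on S K \<longleftrightarrow> (\<forall>x\<in>S. \<forall>y\<in>S. \<exists>g\<in>K. g x = y)"

definition primitive_on :: "'a set \<Rightarrow> ('a \<Rightarrow> 'a) set \<Rightarrow> bool" where
  "primitive_on S K \<longleftrightarrow> transitive_on S K \<and>
     (\<forall>P. partition_on S P \<and> (\<forall>g\<in>K. (`) g ` P = P) \<longrightarrow> P = {S} \<or> P = (\<lambda>x. {x}) ` S)"

definition regular_on :: "'a set \<Rightarrow> ('a \<Rightarrow> 'a) set \<Rightarrow> bool" where
  "regular_on S K \<longleftrightarrow> transitive_on S K \<and> (\<forall>x\<in>S. {g \<in> K. g x = x} = {id})"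

text \<open>
  \<open>coord_act I h \<sigma>\<close> is \<open>h\<^sup>\<sigma>\<close>, whose \<open>i\<close>-th coordinate is \<open>h (i \<sigma>\<^sup>-\<^sup>1)\<close>. The pair \<open>(h, \<sigma>)\<close> of the
  wreath product stands for the product \<open>h \<sigma>\<close>, so that
  \<open>(h \<sigma>) (h' \<sigma>') = h (\<sigma> h' \<sigma>\<^sup>-\<^sup>1) (\<sigma> \<sigma>')\<close>, with \<open>\<sigma> h' \<sigma>\<^sup>-\<^sup>1\<close> the image of \<open>h'\<close> under \<open>\<sigma>\<^sup>-\<^sup>1\<close>.
\<close>

definition coord_act :: "'i set \<Rightarrow> ('i \<Rightarrow> 'g) \<Rightarrow> ('i \<Rightarrow> 'i) \<Rightarrow> ('i \<Rightarrow> 'g)" where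
  "coord_act I h \<sigma> = (\<lambda>i\<in>I. h ((inv\<^bsub>Sym I\<^esub> \<sigma>) i))"

definition wreath ::
    "('g, 'm) monoid_scheme \<Rightarrow> 'i set \<Rightarrow> ('i \<Rightarrow> 'i) set \<Rightarrow> (('i \<Rightarrow> 'g) \<times> ('i \<Rightarrow> 'i)) monoid" where
  "wreath K I L =
     \<lparr>carrier = carrier (product_group I (\<lambda>_. K)) \<times> L,
      monoid.mult = (\<lambda>(h, \<sigma>) (h', \<sigma>').
        (h \<otimes>\<^bsub>product_group I (\<lambda>_. K)\<^esub> coord_act I h' (inv\<^bsub>Sym I\<^esub> \<sigma>), \<sigma> \<otimes>\<^bsub>Sym I\<^esub> \<sigma>')),
      one = (\<one>\<^bsub>product_group I (\<lambda>_. K)\<^esub>, \<one>\<^bsub>Sym I\<^esub>)\<rparr>"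

text \<open>An action is a map \<open>act\<close>, with \<open>act \<omega> g\<close> standing for \<open>\<omega>\<^sup>g\<close>.\<close>

definition natural_act :: "'a \<Rightarrow> ('a \<Rightarrow> 'a) \<Rightarrow> 'a" where
  "natural_act x g = g x"

definition imprimitive_act ::
    "'d \<times> 'i \<Rightarrow> ('i \<Rightarrow> 'd \<Rightarrow> 'd) \<times> ('i \<Rightarrow> 'i) \<Rightarrow> 'd \<times> 'i" where
  "imprimitive_act = (\<lambda>(\<delta>, i) (h, \<sigma>). (h i \<delta>, \<sigma> i))"

definition right_action ::
    "('g, 'm) monoid_scheme \<Rightarrow> 'w set \<Rightarrow> ('w \<Rightarrow> 'g \<Rightarrow> 'w) \<Rightarrow> bool" where
  "right_action G \<Omega> act \<longleftrightarrow>
     (\<forall>\<omega>\<in>\<Omega>. \<forall>g\<in>carrier G. act \<omega> g \<in> \<Omega>) \<and>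
     (\<forall>\<omega>\<in>\<Omega>. act \<omega> \<one>\<^bsub>G\<^esub> = \<omega>) \<and>
     (\<forall>\<omega>\<in>\<Omega>. \<forall>g\<in>carrier G. \<forall>h\<in>carrier G. act \<omega> (g \<otimes>\<^bsub>G\<^esub> h) = act (act \<omega> g) h)"

lemma group_Sym: "group (Sym S)"
proof (rule groupI)
  show "\<exists>y\<in>carrier (Sym S). y \<otimes>\<^bsub>Sym S\<^esub> x = \<one>\<^bsub>Sym S\<^esub>" if "x \<in> carrier (Sym S)" for x
    using that permutes_inv[of x S] permutes_inv_o[of x S] by (auto simp: Sym_def)
qed (auto simp: Sym_def permutes_compose permutes_id o_assoc)

lemma carrier_Sym [simp]: "carrier (Sym S) = {f. f permutes S}"
  and mult_Sym [simp]: "f \<otimes>\<^bsub>Sym S\<^esub> g = g \<circ> f"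
  and one_Sym [simp]: "\<one>\<^bsub>Sym S\<^esub> = id"
  by (simp_all add: Sym_def)

lemma inv_Sym:
  assumes "f permutes S"
  shows "inv\<^bsub>Sym S\<^esub> f = inv_into UNIV f"
  by (rule group.inv_equality[OF group_Sym])
    (use assms in \<open>auto simp: permutes_inv permutes_inv_o\<close>)

lemma group_perm_group: "subgroup K (Sym S) \<Longrightarrow> group (perm_group S K)"
  by (rule subgroup.subgroup_is_group[OF _ group_Sym])

lemma right_action_natural_act: "subgroup K (Sym S) \<Longrightarrow> right_action (perm_group S K) S natural_act"
  using subgroup.subset by (fastforce simp: right_action_def natural_act_def permutes_in_image)

lemma coord_act_inv:
  assumes "\<sigma> permutes I"
  shows "coord_act I h (inv\<^bsub>Sym I\<^esub> \<sigma>) = (\<lambda>i\<in>I. h (\<sigma> i))"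
  using assms group.inv_inv[OF group_Sym, of \<sigma> I] by (simp add: coord_act_def)

lemma mult_wreath:
  assumes "\<sigma> permutes I"
  shows "(h, \<sigma>) \<otimes>\<^bsub>wreath K I L\<^esub> (h', \<sigma>') = ((\<lambda>i\<in>I. h i \<otimes>\<^bsub>K\<^esub> h' (\<sigma> i)), \<sigma>' \<circ> \<sigma>)"
  by (auto simp: wreath_def coord_act_inv[OF assms] fun_eq_iff)

lemma carrier_wreath: "carrier (wreath K I L) = (\<Pi>\<^sub>E i\<in>I. carrier K) \<times> L"
  by (simp add: wreath_def)

lemma one_wreath: "\<one>\<^bsub>wreath K I L\<^esub> = ((\<lambda>i\<in>I. \<one>\<^bsub>K\<^esub>), id)"
  by (simp add: wreath_def)

lemma group_wreath:
  assumes K: "group K" and L: "subgroup L (Sym I)"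
  shows "group (wreath K I L)"
proof -
  interpret K: group K by (rule K)
  have perm: "\<sigma> permutes I" if "\<sigma> \<in> L" for \<sigma>
    using subgroup.subset[OF L] that by auto
  have comp: "\<tau> \<circ> \<sigma> \<in> L" if "\<sigma> \<in> L" "\<tau> \<in> L" for \<sigma> \<tau>
    using subgroup.m_closed[OF L that] by simp
  have idL: "id \<in> L"
    using subgroup.one_closed[OF L] by simp
  have im: "\<sigma> i \<in> I" if "\<sigma> \<in> L" "i \<in> I" for \<sigma> i
    using perm[OF that(1)] that(2) by (simp add: permutes_in_image)
  show ?thesis
  proof (rule groupI)
    fix x y assume "x \<in> carrier (wreath K I L)" "y \<in> carrier (wreath K I L)"
    then obtain h \<sigma> h' \<sigma>' where xy: "x = (h, \<sigma>)" "y = (h', \<sigma>')"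
      and mem: "h \<in> (\<Pi>\<^sub>E i\<in>I. carrier K)" "\<sigma> \<in> L" "h' \<in> (\<Pi>\<^sub>E i\<in>I. carrier K)" "\<sigma>' \<in> L"
      by (auto simp: carrier_wreath)
    have "h i \<otimes>\<^bsub>K\<^esub> h' (\<sigma> i) \<in> carrier K" if "i \<in> I" for i
      using mem that im by (blast intro: K.m_closed)
    then show "x \<otimes>\<^bsub>wreath K I L\<^esub> y \<in> carrier (wreath K I L)"
      using mem by (simp add: xy mult_wreath perm carrier_wreath comp)
  next
    show "\<one>\<^bsub>wreath K I L\<^esub> \<in> carrier (wreath K I L)"
      by (auto simp: carrier_wreath one_wreath idL)
  next
    fix x y z
    assume "x \<in> carrier (wreath K I L)" "y \<in> carrier (wreath K I L)" "z \<in> carrier (wreath K I L)"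
    then obtain h \<sigma> h' \<sigma>' h'' \<sigma>'' where xyz: "x = (h, \<sigma>)" "y = (h', \<sigma>')" "z = (h'', \<sigma>'')"
      and mem: "h \<in> (\<Pi>\<^sub>E i\<in>I. carrier K)" "\<sigma> \<in> L" "h' \<in> (\<Pi>\<^sub>E i\<in>I. carrier K)" "\<sigma>' \<in> L"
        "h'' \<in> (\<Pi>\<^sub>E i\<in>I. carrier K)" "\<sigma>'' \<in> L"
      by (auto simp: carrier_wreath)
    have "h i \<otimes>\<^bsub>K\<^esub> h' (\<sigma> i) \<otimes>\<^bsub>K\<^esub> h'' (\<sigma>' (\<sigma> i)) = h i \<otimes>\<^bsub>K\<^esub> (h' (\<sigma> i) \<otimes>\<^bsub>K\<^esub> h'' (\<sigma>' (\<sigma> i)))"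
      if "i \<in> I" for i
      using mem that im by (blast intro: K.m_assoc)
    then show "x \<otimes>\<^bsub>wreath K I L\<^esub> y \<otimes>\<^bsub>wreath K I L\<^esub> z = x \<otimes>\<^bsub>wreath K I L\<^esub> (y \<otimes>\<^bsub>wreath K I L\<^esub> z)"
      using mem by (simp add: xyz mult_wreath perm comp im o_assoc cong: restrict_cong)
  next
    fix x assume "x \<in> carrier (wreath K I L)"
    then obtain h \<sigma> where x: "x = (h, \<sigma>)" and h: "h \<in> (\<Pi>\<^sub>E i\<in>I. carrier K)"
      by (auto simp: carrier_wreath)
    have "(\<lambda>i\<in>I. \<one>\<^bsub>K\<^esub> \<otimes>\<^bsub>K\<^esub> h i) = h"
      by (rule PiE_ext[OF _ h]) (use h in \<open>auto intro!: K.l_one elim: PiE_mem\<close>)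
    then show "\<one>\<^bsub>wreath K I L\<^esub> \<otimes>\<^bsub>wreath K I L\<^esub> x = x"
      by (simp add: x one_wreath mult_wreath permutes_id cong: restrict_cong)
  next
    fix x assume x: "x \<in> carrier (wreath K I L)"
    obtain h \<sigma> where [simp]: "x = (h, \<sigma>)" by (cases x)
    have h: "h i \<in> carrier K" if "i \<in> I" for i
      using x that by (auto simp: carrier_wreath)
    have s: "\<sigma> \<in> L"
      using x by (simp add: carrier_wreath)
    let ?t = "inv_into UNIV \<sigma>"
    have t: "?t \<in> L"
      using subgroup.m_inv_closed[OF L s] inv_Sym[OF perm[OF s]] by simp
    let ?y = "((\<lambda>i\<in>I. inv\<^bsub>K\<^esub> h (?t i)), ?t)"
    have "?y \<in> carrier (wreath K I L)"
      using t h im by (auto simp: carrier_wreath)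
    moreover have "?y \<otimes>\<^bsub>wreath K I L\<^esub> x = \<one>\<^bsub>wreath K I L\<^esub>"
      using t h im by (auto simp: mult_wreath perm one_wreath fun_eq_iff permutes_inverses[OF perm[OF s]])
    ultimately show "\<exists>y\<in>carrier (wreath K I L). y \<otimes>\<^bsub>wreath K I L\<^esub> x = \<one>\<^bsub>wreath K I L\<^esub>"
      by blast
  qed
qed

lemma right_action_imprimitive_act:
  assumes K: "subgroup K (Sym \<Delta>)" and L: "subgroup L (Sym I)"
  shows "right_action (wreath (perm_group \<Delta> K) I L) (\<Delta> \<times> I) imprimitive_act"
proof -
  have K': "k \<delta> \<in> \<Delta>" if "k \<in> K" "\<delta> \<in> \<Delta>" for k \<delta>
    using subgroup.subset[OF K] that by (auto simp: permutes_in_image)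
  have L': "\<sigma> permutes I" if "\<sigma> \<in> L" for \<sigma>
    using subgroup.subset[OF L] that by auto
  have L'': "\<sigma> i \<in> I" if "\<sigma> \<in> L" "i \<in> I" for \<sigma> i
    using L'[OF that(1)] that(2) by (simp add: permutes_in_image)
  show ?thesis
    unfolding right_action_def
  proof (intro conjI ballI)
    fix \<omega> g assume "\<omega> \<in> \<Delta> \<times> I" "g \<in> carrier (wreath (perm_group \<Delta> K) I L)"
    then show "imprimitive_act \<omega> g \<in> \<Delta> \<times> I"
      using K' L'' by (auto simp: imprimitive_act_def carrier_wreath PiE_iff)
  next
    fix \<omega> assume "\<omega> \<in> \<Delta> \<times> I"
    then show "imprimitive_act \<omega> \<one>\<^bsub>wreath (perm_group \<Delta> K) I L\<^esub> = \<omega>"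
      by (auto simp: imprimitive_act_def one_wreath)
  next
    fix \<omega> g h
    assume "\<omega> \<in> \<Delta> \<times> I" "g \<in> carrier (wreath (perm_group \<Delta> K) I L)"
      "h \<in> carrier (wreath (perm_group \<Delta> K) I L)"
    then show "imprimitive_act \<omega> (g \<otimes>\<^bsub>wreath (perm_group \<Delta> K) I L\<^esub> h) =
        imprimitive_act (imprimitive_act \<omega> g) h"
      by (auto simp: imprimitive_act_def carrier_wreath mult_wreath L')
  qed
qed

text \<open>
  The vector space \<open>V\<close> is a subspace of an ambient vector space with scalar multiplication \<open>s\<close>
  (which may be \<open>V\<close> itself).
\<close>

definition GL :: "('f::field \<Rightarrow> 'v::ab_group_add \<Rightarrow> 'v) \<Rightarrow> 'v set \<Rightarrow> ('v \<Rightarrow> 'v) monoid" where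
  "GL s V = (Sym V)\<lparr>carrier :=
     {f. f permutes V \<and> (\<forall>x\<in>V. \<forall>y\<in>V. f (x + y) = f x + f y) \<and> (\<forall>c. \<forall>x\<in>V. f (s c x) = s c (f x))}\<rparr>"

definition representation_of ::
    "('f::field \<Rightarrow> 'v::ab_group_add \<Rightarrow> 'v) \<Rightarrow> ('g, 'm) monoid_scheme \<Rightarrow> 'w set \<Rightarrow> ('w \<Rightarrow> 'g \<Rightarrow> 'w) \<Rightarrow>
     'v set \<Rightarrow> ('g \<Rightarrow> 'v \<Rightarrow> 'v) \<Rightarrow> ('w \<Rightarrow> 'v) \<Rightarrow> bool" where
  "representation_of s G \<Omega> act V \<rho> \<phi> \<longleftrightarrow>
     vector_space s \<and> module.subspace s V \<and> \<rho> \<in> hom G (GL s V) \<and>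
     \<phi> \<in> \<Omega> \<rightarrow> V \<and> inj_on \<phi> \<Omega> \<and>
     (\<forall>\<omega>\<in>\<Omega>. \<forall>g\<in>carrier G. \<phi> (act \<omega> g) = \<rho> g (\<phi> \<omega>))"

definition basis_of :: "('f::field \<Rightarrow> 'v::ab_group_add \<Rightarrow> 'v) \<Rightarrow> 'v set \<Rightarrow> 'v set \<Rightarrow> bool" where
  "basis_of s B V \<longleftrightarrow> \<not> module.dependent s B \<and> module.span s B = V"

definition fun_scale :: "'f::field \<Rightarrow> ('w \<Rightarrow> 'f) \<Rightarrow> ('w \<Rightarrow> 'f)" where
  "fun_scale c v = (\<lambda>x. c * v x)"

text \<open>
  Dimensions are cardinals, so that \<open>\<Omega>\<close> may be infinite; an equation between dimensions is stated
  with \<open>=o\<close>. A definition cannot range over all types of vectors, so the minimum is taken over the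
  subspaces of the space of all functions from the type of points to the field. This loses nothing:
  by \<open>LinDim_attained\<close> and \<open>LinDim_le\<close> below it is the minimum over all vector spaces.
\<close>

definition rep_dims ::
    "'f::field itself \<Rightarrow> ('g, 'm) monoid_scheme \<Rightarrow> 'w set \<Rightarrow> ('w \<Rightarrow> 'g \<Rightarrow> 'w) \<Rightarrow> ('w \<Rightarrow> 'f) rel set" where
  "rep_dims _ G \<Omega> act =
     {|B| | B V \<rho> \<phi>. representation_of (fun_scale :: 'f \<Rightarrow> _) G \<Omega> act V \<rho> \<phi> \<and> basis_of fun_scale B V}"

definition LinDim ::
    "'f::field itself \<Rightarrow> ('g, 'm) monoid_scheme \<Rightarrow> 'w set \<Rightarrow> ('w \<Rightarrow> 'g \<Rightarrow> 'w) \<Rightarrow> ('w \<Rightarrow> 'f) rel" where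
  "LinDim F G \<Omega> act =
     (SOME r. r \<in> rep_dims F G \<Omega> act \<and> (\<forall>r' \<in> rep_dims F G \<Omega> act. r \<le>o r'))"

lemma vector_space_fun_scale: "vector_space (fun_scale :: 'f::field \<Rightarrow> ('w \<Rightarrow> 'f) \<Rightarrow> _)"
  by unfold_locales (auto simp: fun_scale_def fun_eq_iff algebra_simps)

lemma (in vector_space) independent_card_of_le:
  assumes C: "independent C" and CB: "C \<subseteq> span B"
  shows "|C| \<le>o |B|"
proof (cases "finite B")
  case True
  then have "finite C \<and> card C \<le> card B"
    using independent_span_bound C CB by blast
  with True show ?thesis
    by (metis card_le_inj card_of_ordLeq)
next
  case False
  obtain D where D: "C \<subseteq> D" "D \<subseteq> span B" "independent D" "span B \<subseteq> span D"
    using maximal_independent_subset_extend[OF CB C] by blast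
  have "\<exists>T. finite T \<and> T \<subseteq> D \<and> b \<in> span T" if b: "b \<in> B" for b
  proof -
    have "b \<in> span D"
      using D(4) span_superset b by blast
    then obtain t r where "finite t" "t \<subseteq> D" "b = (\<Sum>a\<in>t. scale (r a) a)"
      unfolding span_explicit by blast
    then show ?thesis
      by (intro exI[of _ t]) (auto intro!: span_sum span_scale intro: span_base)
  qed
  then obtain T where T: "\<And>b. b \<in> B \<Longrightarrow> finite (T b) \<and> T b \<subseteq> D \<and> b \<in> span (T b)"
    by metis
  let ?U = "\<Union>b\<in>B. T b"
  have "D \<subseteq> ?U"
  proof
    fix d assume d: "d \<in> D"
    show "d \<in> ?U"
    proof (rule ccontr)
      assume nd: "d \<notin> ?U"
      have "B \<subseteq> span ?U"
        using T span_mono[of "T _" ?U] by blast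
      then have "span B \<subseteq> span ?U"
        by (simp add: span_minimal)
      also have "span ?U \<subseteq> span (D - {d})"
        by (rule span_mono) (use T nd in blast)
      finally have "d \<in> span (D - {d})"
        using D(2) d by blast
      then show False
        using D(3) d dependent_def by blast
    qed
  qed
  then have "|C| \<le>o |?U|"
    using D(1) by (meson card_of_mono1 order_trans)
  also have "|?U| \<le>o |B|"
  proof (rule card_of_UNION_ordLeq_infinite[OF False])
    show "|B| \<le>o |B|"
      by (rule card_of_mono1) simp
    show "\<forall>b\<in>B. |T b| \<le>o |B|"
      using T False by (auto intro!: ordLess_imp_ordLeq finite_ordLess_infinite card_of_Well_order
          simp: Field_card_of)
  qed
  finally show ?thesis .
qed

lemma representation_ofI:
  fixes s :: "'f::field \<Rightarrow> 'v::ab_group_add \<Rightarrow> 'v"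
  assumes G: "group G" and vs: "vector_space s" and V: "module.subspace s V"
    and R: "\<And>g v. g \<in> carrier G \<Longrightarrow> v \<in> V \<Longrightarrow> R g v \<in> V"
    and R1: "\<And>v. v \<in> V \<Longrightarrow> R \<one>\<^bsub>G\<^esub> v = v"
    and Rm: "\<And>g h v. g \<in> carrier G \<Longrightarrow> h \<in> carrier G \<Longrightarrow> v \<in> V \<Longrightarrow> R (g \<otimes>\<^bsub>G\<^esub> h) v = R h (R g v)"
    and Ra: "\<And>g v w. g \<in> carrier G \<Longrightarrow> v \<in> V \<Longrightarrow> w \<in> V \<Longrightarrow> R g (v + w) = R g v + R g w"
    and Rs: "\<And>g c v. g \<in> carrier G \<Longrightarrow> v \<in> V \<Longrightarrow> R g (s c v) = s c (R g v)"
    and phi: "\<phi> \<in> \<Omega> \<rightarrow> V" "inj_on \<phi> \<Omega>"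
      "\<And>\<omega> g. \<omega> \<in> \<Omega> \<Longrightarrow> g \<in> carrier G \<Longrightarrow> \<phi> (act \<omega> g) = R g (\<phi> \<omega>)"
  shows "representation_of s G \<Omega> act V (\<lambda>g v. if v \<in> V then R g v else v) \<phi>"
proof -
  interpret group G by (rule G)
  interpret vector_space s by (rule vs)
  let ?r = "\<lambda>g v. if v \<in> V then R g v else v"
  have "?r g permutes V" if g: "g \<in> carrier G" for g
  proof (rule bij_imp_permutes)
    show "bij_betw (?r g) V V"
    proof (rule bij_betw_byWitness[where f' = "?r (inv\<^bsub>G\<^esub> g)"])
      show "\<forall>a\<in>V. ?r (inv\<^bsub>G\<^esub> g) (?r g a) = a"
        using g by (simp add: R R1 flip: Rm)
      show "\<forall>a\<in>V. ?r g (?r (inv\<^bsub>G\<^esub> g) a) = a"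
        using g by (simp add: R R1 flip: Rm)
    qed (use R g in auto)
  qed simp
  then have "?r \<in> hom G (GL s V)"
    using R Rm Ra Rs V by (auto simp: hom_def GL_def Sym_def fun_eq_iff subspace_add subspace_scale)
  then show ?thesis
    using phi vs V unfolding representation_of_def by (auto simp: Pi_iff)
qed

lemma rep_dims_Card_order: "r \<in> rep_dims F G \<Omega> act \<Longrightarrow> Card_order r"
  by (auto simp: rep_dims_def card_of_Card_order)

lemma LinDim_minimum:
  assumes "rep_dims F G \<Omega> act \<noteq> {}"
  shows "LinDim F G \<Omega> act \<in> rep_dims F G \<Omega> act"
    and "r \<in> rep_dims F G \<Omega> act \<Longrightarrow> LinDim F G \<Omega> act \<le>o r"
proof -
  have "\<exists>r. r \<in> rep_dims F G \<Omega> act \<and> (\<forall>r' \<in> rep_dims F G \<Omega> act. r \<le>o r')"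
    using exists_minim_Card_order[OF assms] rep_dims_Card_order by blast
  from someI_ex[OF this] show "LinDim F G \<Omega> act \<in> rep_dims F G \<Omega> act"
    and "r \<in> rep_dims F G \<Omega> act \<Longrightarrow> LinDim F G \<Omega> act \<le>o r"
    by (auto simp: LinDim_def)
qed

definition point_vec :: "'w \<Rightarrow> 'w \<Rightarrow> 'f::field" where
  "point_vec w = (\<lambda>x. if x = w then 1 else 0)"

lemma inj_point_vec: "inj (point_vec :: 'w \<Rightarrow> 'w \<Rightarrow> 'f::field)"
  by (rule injI) (metis point_vec_def zero_neq_one)

lemma independent_point_vec:
  "\<not> module.dependent (fun_scale :: 'f::field \<Rightarrow> _) (point_vec ` A)"
proof -
  interpret vector_space "fun_scale :: 'f \<Rightarrow> ('a \<Rightarrow> 'f) \<Rightarrow> _" by (rule vector_space_fun_scale)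
  have sub: "subspace {v :: 'a \<Rightarrow> 'f. v a = 0}" for a
    by (auto simp: subspace_def fun_scale_def)
  have "(point_vec a :: 'a \<Rightarrow> 'f) \<notin> span (point_vec ` A - {point_vec a})" for a
  proof
    assume *: "(point_vec a :: 'a \<Rightarrow> 'f) \<in> span (point_vec ` A - {point_vec a})"
    have "point_vec ` A - {point_vec a} \<subseteq> {v :: 'a \<Rightarrow> 'f. v a = 0}"
      by (auto simp: point_vec_def)
    then have "(point_vec a :: 'a \<Rightarrow> 'f) a = 0"
      using * span_minimal[OF _ sub] by blast
    then show False
      by (simp add: point_vec_def)
  qed
  then show ?thesis
    unfolding dependent_def by blast
qed

text \<open>The permutation module affords a representation, so the minimum exists.\<close>

lemma rep_dims_nonempty:
  fixes act :: "'w \<Rightarrow> 'g \<Rightarrow> 'w"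
  assumes G: "group G" and act: "right_action G \<Omega> act"
  shows "rep_dims TYPE('f::field) G \<Omega> act \<noteq> {}"
proof -
  interpret group G by (rule G)
  interpret vector_space "fun_scale :: 'f \<Rightarrow> ('w \<Rightarrow> 'f) \<Rightarrow> _" by (rule vector_space_fun_scale)
  let ?B = "point_vec ` \<Omega> :: ('w \<Rightarrow> 'f) set"
  let ?V = "span ?B"
  let ?R = "\<lambda>g (v :: 'w \<Rightarrow> 'f) \<omega>. if \<omega> \<in> \<Omega> then v (act \<omega> (inv\<^bsub>G\<^esub> g)) else 0"
  have cl: "act \<omega> g \<in> \<Omega>" if "\<omega> \<in> \<Omega>" "g \<in> carrier G" for \<omega> g
    using act that by (simp add: right_action_def)
  have one: "act \<omega> \<one>\<^bsub>G\<^esub> = \<omega>" if "\<omega> \<in> \<Omega>" for \<omega>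
    using act that by (simp add: right_action_def)
  have mlt: "act (act \<omega> g) h = act \<omega> (g \<otimes>\<^bsub>G\<^esub> h)" if "\<omega> \<in> \<Omega>" "g \<in> carrier G" "h \<in> carrier G" for \<omega> g h
    using act that by (simp add: right_action_def)
  have Rp: "?R g (point_vec \<omega>) = point_vec (act \<omega> g)" if w: "\<omega> \<in> \<Omega>" and g: "g \<in> carrier G" for g \<omega>
  proof
    fix x
    have "act x (inv\<^bsub>G\<^esub> g) = \<omega> \<longleftrightarrow> x = act \<omega> g" if "x \<in> \<Omega>"
      using that w g by (metis cl one mlt inv_closed l_inv r_inv)
    then show "?R g (point_vec \<omega>) x = point_vec (act \<omega> g) x"
      using cl[OF w g] by (auto simp: point_vec_def)
  qed
  have out: "v x = 0" if "v \<in> ?V" "x \<notin> \<Omega>" for v x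
  proof -
    have "subspace {v :: 'w \<Rightarrow> 'f. v x = 0}"
      by (auto simp: subspace_def fun_scale_def)
    moreover have "?B \<subseteq> {v :: 'w \<Rightarrow> 'f. v x = 0}"
      using that(2) by (auto simp: point_vec_def)
    ultimately show ?thesis
      using span_minimal that(1) by blast
  qed
  have R: "?R g v \<in> ?V" if g: "g \<in> carrier G" and v: "v \<in> ?V" for g v
  proof -
    have "?R g (v + w) = ?R g v + ?R g w" "?R g 0 = 0" "?R g (fun_scale c v) = fun_scale c (?R g v)" for v w c
      by (auto simp: fun_eq_iff fun_scale_def)
    then have "subspace {v. ?R g v \<in> ?V}"
      unfolding subspace_def by (auto intro: span_add span_scale span_zero)
    moreover have "?B \<subseteq> {v. ?R g v \<in> ?V}"
      using Rp g cl by (auto intro!: span_base)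
    ultimately show ?thesis
      using span_minimal v by blast
  qed
  have "representation_of fun_scale G \<Omega> act ?V (\<lambda>g v. if v \<in> ?V then ?R g v else v) point_vec"
  proof (rule representation_ofI[OF G vector_space_fun_scale subspace_span R])
    show "?R \<one>\<^bsub>G\<^esub> v = v" if "v \<in> ?V" for v
      using out[OF that] by (auto simp: fun_eq_iff one)
    show "?R (g \<otimes>\<^bsub>G\<^esub> h) v = ?R h (?R g v)" if "g \<in> carrier G" "h \<in> carrier G" for g h v
      using that by (auto simp: fun_eq_iff mlt cl inv_mult_group)
    show "inj_on (point_vec :: 'w \<Rightarrow> 'w \<Rightarrow> 'f) \<Omega>"
      using inj_point_vec by (rule inj_on_subset) simp
  qed (auto simp: fun_eq_iff fun_scale_def Rp intro: span_base)
  then have "|?B| \<in> rep_dims TYPE('f) G \<Omega> act"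
    unfolding rep_dims_def basis_of_def using independent_point_vec by blast
  then show ?thesis
    by blast
qed

theorem LinDim_attained:
  fixes act :: "'w \<Rightarrow> 'g \<Rightarrow> 'w"
  assumes "group G" "right_action G \<Omega> act"
  shows "\<exists>V \<rho> \<phi> B. representation_of (fun_scale :: 'f::field \<Rightarrow> ('w \<Rightarrow> 'f) \<Rightarrow> _) G \<Omega> act V \<rho> \<phi> \<and>
    basis_of fun_scale B V \<and> LinDim TYPE('f) G \<Omega> act = |B|"
  using LinDim_minimum(1)[OF rep_dims_nonempty[OF assms, where 'f = 'f]]
  by (auto simp: rep_dims_def)

theorem LinDim_le:
  fixes s :: "'f::field \<Rightarrow> 'v::ab_group_add \<Rightarrow> 'v" and act :: "'w \<Rightarrow> 'g \<Rightarrow> 'w"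
  assumes G: "group G" and act: "right_action G \<Omega> act"
    and rep: "representation_of s G \<Omega> act V \<rho> \<phi>" and B: "basis_of s B V"
  shows "LinDim TYPE('f) G \<Omega> act \<le>o |B|"
proof -
  interpret group G by (rule G)
  interpret vector_space_pair s "fun_scale :: 'f \<Rightarrow> ('w \<Rightarrow> 'f) \<Rightarrow> _"
    using rep vector_space_fun_scale by (simp add: vector_space_pair_def representation_of_def)
  have V: "vs1.subspace V" and hom: "\<rho> \<in> hom G (GL s V)" and phiV: "\<phi> ` \<Omega> \<subseteq> V"
    and inj: "inj_on \<phi> \<Omega>"
    and eqv: "\<And>\<omega> g. \<omega> \<in> \<Omega> \<Longrightarrow> g \<in> carrier G \<Longrightarrow> \<phi> (act \<omega> g) = \<rho> g (\<phi> \<omega>)"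
    using rep by (auto simp: representation_of_def)
  have cl: "act \<omega> g \<in> \<Omega>" if "\<omega> \<in> \<Omega>" "g \<in> carrier G" for \<omega> g
    using act that by (simp add: right_action_def)
  have gl: "\<rho> g permutes V" "\<And>x y. x \<in> V \<Longrightarrow> y \<in> V \<Longrightarrow> \<rho> g (x + y) = \<rho> g x + \<rho> g y"
    "\<And>c x. x \<in> V \<Longrightarrow> \<rho> g (s c x) = s c (\<rho> g x)" if "g \<in> carrier G" for g
    using hom that by (auto simp: hom_def GL_def Pi_iff)
  have mlt: "\<rho> (g \<otimes>\<^bsub>G\<^esub> h) v = \<rho> h (\<rho> g v)" if "g \<in> carrier G" "h \<in> carrier G" for g h v
    using hom that by (auto simp: hom_def GL_def Sym_def)
  have one: "\<rho> \<one>\<^bsub>G\<^esub> v = v" for v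
  proof -
    have "\<rho> \<one>\<^bsub>G\<^esub> (\<rho> \<one>\<^bsub>G\<^esub> v) = \<rho> \<one>\<^bsub>G\<^esub> v"
      using mlt[of "\<one>\<^bsub>G\<^esub>" "\<one>\<^bsub>G\<^esub>" v] by simp
    then show ?thesis
      using permutes_inj[OF gl(1)[OF one_closed]] by (auto dest: injD)
  qed
  let ?W = "vs1.span (\<phi> ` \<Omega>)"
  have WV: "?W \<subseteq> V"
    using vs1.span_minimal[OF phiV V] .
  have W: "\<rho> g v \<in> ?W" if g: "g \<in> carrier G" and v: "v \<in> ?W" for g v
  proof -
    have "\<rho> g 0 = 0"
      using gl(2)[OF g, of 0 0] vs1.subspace_0[OF V] by simp
    then have "vs1.subspace {v \<in> V. \<rho> g v \<in> ?W}"
      using V gl[OF g] unfolding vs1.subspace_def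
      by (auto intro: vs1.span_add vs1.span_scale vs1.span_zero)
    moreover have "\<phi> ` \<Omega> \<subseteq> {v \<in> V. \<rho> g v \<in> ?W}"
      using phiV cl g by (auto simp flip: eqv intro!: vs1.span_base)
    ultimately show ?thesis
      using vs1.span_minimal v by blast
  qed
  obtain C where C: "C \<subseteq> \<phi> ` \<Omega>" "vs1.independent C" "\<phi> ` \<Omega> \<subseteq> vs1.span C"
    using vs1.maximal_independent_subset[of "\<phi> ` \<Omega>"] by blast
  have CW: "vs1.span C = ?W"
    using C(1,3) by (metis vs1.span_mono vs1.span_minimal vs1.subspace_span subset_antisym)
  obtain T where linT: "Vector_Spaces.linear s fun_scale T" and injT: "inj_on T ?W"
    and ind: "vs2.independent (T ` C)"
  proof -
    let ?e = "\<lambda>v. point_vec (inv_into \<Omega> \<phi> v) :: 'w \<Rightarrow> 'f"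
    let ?T = "construct C ?e"
    have lin: "Vector_Spaces.linear s fun_scale ?T"
      by (rule linear_construct[OF C(2)])
    have "?T ` C = point_vec ` (inv_into \<Omega> \<phi> ` C)"
      by (auto simp: construct_basis[OF C(2)] image_image cong: image_cong)
    then have ind: "vs2.independent (?T ` C)"
      by (simp add: independent_point_vec)
    have "inj_on ?e C"
      using C(1) by (intro inj_onI) (metis injD[OF inj_point_vec] inv_into_injective subsetD)
    then have "inj_on ?T C"
      using construct_basis[OF C(2), of _ ?e] by (simp add: inj_on_def)
    then have "inj_on ?T ?W"
      using linear_inj_on_span_iff_independent_image[OF lin ind] CW by simp
    then show ?thesis
      using that lin ind by blast
  qed
  interpret T: Vector_Spaces.linear s fun_scale T
    by (rule linT)
  let ?S = "inv_into ?W T"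
  have ST: "?S (T v) = v" if "v \<in> ?W" for v
    using injT that by (rule inv_into_f_f)
  let ?V = "T ` ?W"
  let ?R = "\<lambda>g y. T (\<rho> g (?S y))"
  have "representation_of fun_scale G \<Omega> act ?V (\<lambda>g y. if y \<in> ?V then ?R g y else y) (T \<circ> \<phi>)"
  proof (rule representation_ofI[OF G vector_space_fun_scale])
    show "vs2.subspace ?V"
      by (rule linear_subspace_image[OF linT vs1.subspace_span])
    show "?R g v \<in> ?V" if "g \<in> carrier G" "v \<in> ?V" for g v
      using that W ST by auto
    show "?R \<one>\<^bsub>G\<^esub> v = v" if "v \<in> ?V" for v
      using that ST one by auto
    show "?R (g \<otimes>\<^bsub>G\<^esub> h) v = ?R h (?R g v)" if "g \<in> carrier G" "h \<in> carrier G" "v \<in> ?V" for g h v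
      using that W ST mlt by auto
    show "?R g (v + w) = ?R g v + ?R g w" if g: "g \<in> carrier G" and vw: "v \<in> ?V" "w \<in> ?V" for g v w
    proof -
      obtain x y where xy: "x \<in> ?W" "v = T x" "y \<in> ?W" "w = T y"
        using vw by blast
      have vw': "v + w = T (x + y)" and m: "x + y \<in> ?W"
        using xy by (simp_all only: T.add vs1.span_add)
      have a: "\<rho> g (x + y) = \<rho> g x + \<rho> g y"
        using xy WV gl(2)[OF g] by blast
      show ?thesis
        unfolding vw' unfolding ST[OF m] a unfolding T.add unfolding xy(2,4) ST[OF xy(1)] ST[OF xy(3)] ..
    qed
    show "?R g (fun_scale c v) = fun_scale c (?R g v)" if g: "g \<in> carrier G" and v: "v \<in> ?V" for g c v
    proof -
      obtain x where x: "x \<in> ?W" "v = T x"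
        using v by blast
      have cv: "fun_scale c v = T (s c x)" and m: "s c x \<in> ?W"
        using x by (simp_all only: T.scale vs1.span_scale)
      have a: "\<rho> g (s c x) = s c (\<rho> g x)"
        using x WV gl(3)[OF g] by blast
      show ?thesis
        unfolding cv unfolding ST[OF m] a unfolding T.scale unfolding x(2) ST[OF x(1)] ..
    qed
    show "T \<circ> \<phi> \<in> \<Omega> \<rightarrow> ?V"
      by (auto intro!: imageI vs1.span_base)
    show "inj_on (T \<circ> \<phi>) \<Omega>"
      by (rule comp_inj_on[OF inj inj_on_subset[OF injT vs1.span_superset]])
    show "(T \<circ> \<phi>) (act \<omega> g) = ?R g ((T \<circ> \<phi>) \<omega>)" if "\<omega> \<in> \<Omega>" "g \<in> carrier G" for \<omega> g
      using that by (simp add: eqv ST vs1.span_base)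
  qed
  moreover have "basis_of fun_scale (T ` C) ?V"
    using ind linear_span_image[OF linT, of C] CW by (simp add: basis_of_def)
  ultimately have "|T ` C| \<in> rep_dims TYPE('f) G \<Omega> act"
    unfolding rep_dims_def by blast
  then have "LinDim TYPE('f) G \<Omega> act \<le>o |T ` C|"
    using LinDim_minimum(2) by blast
  also have "|T ` C| \<le>o |C|"
    by (rule card_of_image)
  also have "|C| \<le>o |B|"
    using C(1) phiV B by (intro vs1.independent_card_of_le[OF C(2)]) (auto simp: basis_of_def)
  finally show ?thesis .
qed

end

theory Submission
  imports Defs "HOL-Algebra.Multiplicative_Group" "HOL-Computational_Algebra.Primes"
begin

text \<open>
  Write \<open>I\<close> for the index set \<open>{1..l}\<close>. Let \<open>V\<close> afford a representation \<open>\<phi>\<close> of the wreath product.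
  The \<open>i\<close>-th coordinate subgroup \<open>K\<^sub>i\<close> acts on the \<open>i\<close>-th fibre \<open>\<Delta> \<times> {i}\<close> as \<open>K\<close> does on \<open>\<Delta>\<close>, and
  fixes pointwise the span \<open>S\<^sub>i\<close> of the images of the other fibres. By primitivity, the points of the
  \<open>i\<close>-th fibre are either all distinct or all equal modulo \<open>S\<^sub>i\<close>.

  \<^item> If they are distinct, then the image of the fibre modulo \<open>S\<^sub>i\<close> affords a representation of \<open>K\<close>, so
    there are at least \<open>LinDim K\<close> vectors in the fibre that are independent modulo \<open>S\<^sub>i\<close>
    (\<open>LinDim_modulo_fixed_subspace\<close>). If this happens for every \<open>i\<close>, all these vectors together are
    independent, which gives the lower bound \<open>l LinDim K\<close> (\<open>card_mult_LinDim_le\<close>).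

  \<^item> If they are equal, then the differences of points of the fibre lie in \<open>S\<^sub>i\<close>, so \<open>K\<^sub>i\<close> fixes them:
    \<open>K\<close> acts on the image of the fibre by translations. Point stabilisers are then trivial, and since
    the cosets of any group of translations cut out blocks of \<open>K\<close>, the translations form a cyclic
    group without proper nontrivial subgroups. A nonzero vector has finite additive order only in
    positive characteristic, and its order is then the characteristic. Hence \<open>K\<close> is regular of degree
    \<open>char F\<close> (\<open>translations_imp_regular_char\<close>), so outside the exceptional case this does not occur.

  In the exceptional case \<open>K\<close> is cyclic of order \<open>p = char F\<close>. One fibre spans at least a plane, since
  the only \<open>p\<close>-th root of unity in \<open>F\<close> is \<open>1\<close>, and a vector from each other fibre adds a dimension,
  which gives \<open>l + 1\<close> (\<open>Suc_card_le\<close>).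

  Both bounds are attained. A direct sum of \<open>l\<close> copies of a minimal representation of \<open>K\<close>, permuted by
  \<open>L\<close>, represents the wreath product (\<open>LinDim_wreath_le_card_mult\<close>). In the exceptional case, let
  \<open>c\<close> identify \<open>\<Delta>\<close> with the prime field so that \<open>K\<close> acts by translations; then
  \<open>(\<delta>, i) \<mapsto> e\<^sub>i + c(\<delta>) e\<^sub>0\<close> affords a representation of dimension \<open>l + 1\<close>, in which all fibres share
  the line of translations spanned by \<open>e\<^sub>0\<close> (\<open>LinDim_wreath_le_Suc_card\<close>).
\<close>

section \<open>Representations of actions\<close>

locale action_rep = vector_space s + G: group G
  for s :: "'f::field \<Rightarrow> 'v::ab_group_add \<Rightarrow> 'v" and G :: "('g, 'm) monoid_scheme" +
  fixes \<Omega> :: "'w set" and act :: "'w \<Rightarrow> 'g \<Rightarrow> 'w"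
    and V :: "'v set" and \<rho> :: "'g \<Rightarrow> 'v \<Rightarrow> 'v" and \<phi> :: "'w \<Rightarrow> 'v"
  assumes action: "right_action G \<Omega> act"
    and rep: "representation_of s G \<Omega> act V \<rho> \<phi>"
begin

lemma subspace_V: "subspace V"
  and phi_mem: "\<omega> \<in> \<Omega> \<Longrightarrow> \<phi> \<omega> \<in> V"
  and inj_phi: "inj_on \<phi> \<Omega>"
  and phi_act: "\<omega> \<in> \<Omega> \<Longrightarrow> g \<in> carrier G \<Longrightarrow> \<phi> (act \<omega> g) = \<rho> g (\<phi> \<omega>)"
  and rho_hom: "\<rho> \<in> hom G (GL s V)"
  using rep by (auto simp: representation_of_def)

lemma rho_permutes: "g \<in> carrier G \<Longrightarrow> \<rho> g permutes V"
  and rho_add: "g \<in> carrier G \<Longrightarrow> v \<in> V \<Longrightarrow> w \<in> V \<Longrightarrow> \<rho> g (v + w) = \<rho> g v + \<rho> g w"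
  and rho_scale: "g \<in> carrier G \<Longrightarrow> v \<in> V \<Longrightarrow> \<rho> g (s c v) = s c (\<rho> g v)"
  using rho_hom by (auto simp: hom_def GL_def Pi_iff)

lemma rho_mem: "g \<in> carrier G \<Longrightarrow> v \<in> V \<Longrightarrow> \<rho> g v \<in> V"
  using rho_permutes by (simp add: permutes_in_image)

lemma rho_zero: "g \<in> carrier G \<Longrightarrow> \<rho> g 0 = 0"
  using rho_scale[of g 0 0] subspace_0[OF subspace_V] by simp

lemma rho_diff:
  assumes "g \<in> carrier G" "v \<in> V" "w \<in> V"
  shows "\<rho> g (v - w) = \<rho> g v - \<rho> g w"
  using rho_add[OF assms(1) subspace_diff[OF subspace_V assms(2,3)] assms(3)] by simp

lemma rho_mult: "g \<in> carrier G \<Longrightarrow> h \<in> carrier G \<Longrightarrow> \<rho> (g \<otimes>\<^bsub>G\<^esub> h) v = \<rho> h (\<rho> g v)"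
  using rho_hom by (auto simp: hom_def GL_def Sym_def)

lemma rho_one: "\<rho> \<one>\<^bsub>G\<^esub> v = v"
proof -
  have "\<rho> \<one>\<^bsub>G\<^esub> (\<rho> \<one>\<^bsub>G\<^esub> v) = \<rho> \<one>\<^bsub>G\<^esub> v"
    using rho_mult[of "\<one>\<^bsub>G\<^esub>" "\<one>\<^bsub>G\<^esub>" v] by simp
  then show ?thesis
    using permutes_inj[OF rho_permutes[OF G.one_closed]] by (auto dest: injD)
qed

definition fixed_vectors :: "'v set" where
  "fixed_vectors = {v \<in> V. \<forall>g\<in>carrier G. \<rho> g v = v}"

lemma subspace_fixed_vectors: "subspace fixed_vectors"
  unfolding fixed_vectors_def using subspace_V
  by (auto simp: subspace_def rho_zero rho_add rho_scale)

text \<open>With \<open>f\<close> the embedding of \<open>K\<close> as a coordinate subgroup of the wreath product and \<open>\<psi>\<close> the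
  inclusion of the corresponding fibre, this makes each fibre a representation of \<open>K\<close>.\<close>

lemma pullback:
  assumes H: "group H" and act': "right_action H \<Delta> act'" and f: "f \<in> hom H G"
    and \<psi>: "\<psi> \<in> \<Delta> \<rightarrow> \<Omega>" "inj_on \<psi> \<Delta>"
    and equivariant: "\<And>\<delta> h. \<delta> \<in> \<Delta> \<Longrightarrow> h \<in> carrier H \<Longrightarrow> \<psi> (act' \<delta> h) = act (\<psi> \<delta>) (f h)"
  shows "action_rep s H \<Delta> act' V (\<rho> \<circ> f) (\<phi> \<circ> \<psi>)"
proof -
  have f_mem: "f h \<in> carrier G" if "h \<in> carrier H" for h
    using f that by (auto simp: hom_def)
  have "\<rho> \<circ> f \<in> hom H (GL s V)"
    using f rho_hom by (auto simp: hom_def Pi_iff)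
  moreover have "inj_on (\<phi> \<circ> \<psi>) \<Delta>"
    using \<psi> by (intro comp_inj_on inj_on_subset[OF inj_phi]) auto
  moreover have "(\<phi> \<circ> \<psi>) (act' \<delta> h) = (\<rho> \<circ> f) h ((\<phi> \<circ> \<psi>) \<delta>)"
    if "\<delta> \<in> \<Delta>" "h \<in> carrier H" for \<delta> h
    using that \<psi>(1) f_mem by (auto simp: equivariant phi_act Pi_iff)
  ultimately have "representation_of s H \<Delta> act' V (\<rho> \<circ> f) (\<phi> \<circ> \<psi>)"
    using funcset_mem[OF \<psi>(1)] phi_mem subspace_V vector_space_axioms
    by (auto simp: representation_of_def)
  then show ?thesis
    using H act' vector_space_axioms by (simp add: action_rep_def action_rep_axioms_def)
qed

end

text \<open>A spanning set is easier to exhibit than a basis, and the two give the same bound.\<close>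

lemma LinDim_le_spanning:
  fixes s :: "'f::field \<Rightarrow> 'v::ab_group_add \<Rightarrow> 'v" and act :: "'w \<Rightarrow> 'g \<Rightarrow> 'w"
  assumes "group G" "right_action G \<Omega> act" and rep: "representation_of s G \<Omega> act V \<rho> \<phi>"
    and A: "V \<subseteq> module.span s A"
  shows "LinDim TYPE('f) G \<Omega> act \<le>o |A|"
proof -
  interpret vector_space s
    using rep by (simp add: representation_of_def)
  obtain B where B: "B \<subseteq> V" "independent B" "V \<subseteq> span B"
    using maximal_independent_subset by blast
  moreover have "span B \<subseteq> V"
    using B(1) rep span_minimal by (auto simp: representation_of_def)
  ultimately have "basis_of s B V"
    by (auto simp: basis_of_def)
  then have "LinDim TYPE('f) G \<Omega> act \<le>o |B|"
    using LinDim_le assms(1-3) by blast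
  also have "|B| \<le>o |A|"
    using B A by (intro independent_card_of_le) auto
  finally show ?thesis .
qed

section \<open>Primitive groups\<close>

text \<open>Primitivity in terms of functions: by hypothesis \<open>K\<close> permutes the parts of the partition of
  \<open>\<Delta>\<close> into the fibres of \<open>f\<close>, so that this partition is trivial.\<close>

lemma primitive_on_fibres:
  assumes K: "subgroup K (Sym \<Delta>)" and prim: "primitive_on \<Delta> K"
    and f: "\<And>g x y. g \<in> K \<Longrightarrow> x \<in> \<Delta> \<Longrightarrow> y \<in> \<Delta> \<Longrightarrow> f x = f y \<Longrightarrow> f (g x) = f (g y)"
  shows "inj_on f \<Delta> \<or> (\<forall>x\<in>\<Delta>. \<forall>y\<in>\<Delta>. f x = f y)"
proof -
  let ?C = "\<lambda>x. {y \<in> \<Delta>. f y = f x}"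
  let ?P = "?C ` \<Delta>"
  have perm: "g permutes \<Delta>" if "g \<in> K" for g
    using subgroup.subset[OF K] that by auto
  have img: "g ` ?C x = ?C (g x)" if g: "g \<in> K" and x: "x \<in> \<Delta>" for g x
  proof
    show "g ` ?C x \<subseteq> ?C (g x)"
      using f[OF g _ x] permutes_in_image[OF perm[OF g]] by auto
    show "?C (g x) \<subseteq> g ` ?C x"
    proof
      fix y assume y: "y \<in> ?C (g x)"
      let ?h = "inv_into UNIV g"
      have h: "?h \<in> K"
        using subgroup.m_inv_closed[OF K g] inv_Sym[OF perm[OF g]] by simp
      have "f (?h y) = f (?h (g x))"
        using f[OF h] y x permutes_in_image[OF perm[OF g]] by auto
      moreover have "?h y \<in> \<Delta>"
        using y permutes_in_image[OF perm[OF h]] by auto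
      ultimately show "y \<in> g ` ?C x"
        using permutes_inverses[OF perm[OF g]] by (intro image_eqI[of _ _ "?h y"]) auto
    qed
  qed
  have "(`) g ` ?P = ?P" if g: "g \<in> K" for g
  proof -
    have "(`) g ` ?P = ?C ` (g ` \<Delta>)"
      using img[OF g] by (auto simp: image_image cong: image_cong)
    then show ?thesis
      using permutes_image[OF perm[OF g]] by simp
  qed
  moreover have "partition_on \<Delta> ?P"
    by (auto simp: partition_on_def disjoint_def)
  ultimately have "?P = {\<Delta>} \<or> ?P = (\<lambda>x. {x}) ` \<Delta>"
    using prim by (simp add: primitive_on_def)
  then show ?thesis
  proof
    assume P: "?P = {\<Delta>}"
    have "?C x = \<Delta>" if "x \<in> \<Delta>" for x
      using imageI[OF that, of ?C] unfolding P by (rule singletonD)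
    then show ?thesis
      by (metis (mono_tags, lifting) mem_Collect_eq)
  next
    assume P: "?P = (\<lambda>x. {x}) ` \<Delta>"
    have "inj_on f \<Delta>"
    proof (rule inj_onI)
      fix x y assume xy: "x \<in> \<Delta>" "y \<in> \<Delta>" "f x = f y"
      obtain z where "?C x = {z}"
        using imageI[OF xy(1), of ?C] unfolding P by (rule imageE)
      then show "x = y"
        using xy by (metis (mono_tags, lifting) mem_Collect_eq singletonD)
    qed
    then show ?thesis ..
  qed
qed

lemma funpow_mem_subgroup_Sym:
  assumes "subgroup K (Sym S)" "g \<in> K"
  shows "g ^^ n \<in> K"
  using assms subgroup.one_closed[OF assms(1)] subgroup.m_closed[OF assms(1) _ assms(2)]
  by (induction n) auto

lemma regular_on_eqI:
  assumes K: "subgroup K (Sym S)" and reg: "regular_on S K"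
    and hk: "h \<in> K" "k \<in> K" and x: "x \<in> S" "h x = k x"
  shows "h = k"
proof -
  have k: "k permutes S"
    using subgroup.subset[OF K] hk(2) by auto
  have "inv_into UNIV k \<in> K"
    using subgroup.m_inv_closed[OF K hk(2)] inv_Sym[OF k] by simp
  then have "inv_into UNIV k \<circ> h \<in> K"
    using subgroup.m_closed[OF K hk(1)] by simp
  moreover have "(inv_into UNIV k \<circ> h) x = x"
    using x permutes_inverses[OF k] by simp
  ultimately have "inv_into UNIV k \<circ> h = id"
    using reg x(1) unfolding regular_on_def by blast
  then show "h = k"
    using permutes_inverses[OF k] by (metis comp_apply ext id_apply)
qed

text \<open>A regular group has as many elements as points, and in a group of prime order every
  nontrivial element is a generator.\<close>

lemma regular_prime_cyclic:
  assumes K: "subgroup K (Sym S)" and reg: "regular_on S K"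
    and p: "card S = p" "prime p" and g: "g \<in> K" "g \<noteq> id"
  shows "g ^^ p = id" and "K = range (\<lambda>n. g ^^ n)" and "g ^^ m = g ^^ n \<longleftrightarrow> m mod p = n mod p"
proof -
  interpret group "perm_group S K"
    by (rule group_perm_group[OF K])
  have pow: "g [^]\<^bsub>perm_group S K\<^esub> n = g ^^ n" for n :: nat
    by (induction n) simp_all
  obtain x where x: "x \<in> S"
    using p by (metis card.empty ex_in_conv not_prime_0)
  have perm: "h permutes S" if "h \<in> K" for h
    using subgroup.subset[OF K] that by auto
  have "bij_betw (\<lambda>h. h x) K S"
  proof (rule bij_betw_imageI)
    show "inj_on (\<lambda>h. h x) K"
      using regular_on_eqI[OF K reg _ _ x] by (rule inj_onI)
    show "(\<lambda>h. h x) ` K = S"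
    proof
      show "(\<lambda>h. h x) ` K \<subseteq> S"
        using x permutes_in_image[OF perm] by auto
      show "S \<subseteq> (\<lambda>h. h x) ` K"
      proof
        fix y assume "y \<in> S"
        then obtain h where "h \<in> K" "h x = y"
          using reg x unfolding regular_on_def transitive_on_def by blast
        then show "y \<in> (\<lambda>h. h x) ` K"
          by blast
      qed
    qed
  qed
  then have card: "card K = p"
    using p bij_betw_same_card by blast
  then have fin: "finite K"
    using p(2) by (metis card.infinite not_prime_0)
  have "ord g dvd p"
    using ord_dvd_group_order[of g] g card by (simp add: order_def)
  moreover have "ord g \<noteq> 1"
    using ord_eq_1[of g] g by simp
  ultimately have ord: "ord g = p"
    using p(2) prime_nat_iff by blast
  have eq: "g ^^ m = g ^^ n \<longleftrightarrow> m mod p = n mod p" for m n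
  proof -
    have "g ^^ m = g ^^ n \<longleftrightarrow> int p dvd int n - int m"
      using int_pow_eq[of g "int m" "int n"] g ord by (simp add: int_pow_int pow)
    then show ?thesis
      by (metis mod_eq_dvd_iff of_nat_eq_iff zmod_int)
  qed
  show "g ^^ m = g ^^ n \<longleftrightarrow> m mod p = n mod p"
    by (rule eq)
  show "g ^^ p = id"
    using eq[of p 0] by simp
  have "inj_on (\<lambda>n. g ^^ n) {..<p}"
    by (auto simp: inj_on_def eq)
  then have "card ((\<lambda>n. g ^^ n) ` {..<p}) = card K"
    by (simp add: card_image card)
  moreover have "range (\<lambda>n. g ^^ n) \<subseteq> K"
    using funpow_mem_subgroup_Sym[OF K g(1)] by auto
  ultimately show "K = range (\<lambda>n. g ^^ n)"
    using card_subset_eq[OF fin, of "(\<lambda>n. g ^^ n) ` {..<p}"] by auto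
qed

section \<open>Representations of primitive groups\<close>

locale primitive_rep =
  action_rep s "perm_group \<Delta> K" \<Delta> natural_act V \<rho> \<phi>
  for s :: "'f::field \<Rightarrow> 'v::ab_group_add \<Rightarrow> 'v" and \<Delta> :: "'d set" and K V \<rho> \<phi> +
  assumes subgroup_K: "subgroup K (Sym \<Delta>)" and primitive_K: "primitive_on \<Delta> K"
    and nontrivial: "\<exists>x\<in>\<Delta>. \<exists>y\<in>\<Delta>. x \<noteq> y"
begin

lemma perm: "g \<in> K \<Longrightarrow> g permutes \<Delta>"
  using subgroup.subset[OF subgroup_K] by auto

lemma perm_mem: "g \<in> K \<Longrightarrow> x \<in> \<Delta> \<Longrightarrow> g x \<in> \<Delta>"
  using permutes_in_image[OF perm] by blast

lemma phi_perm: "g \<in> K \<Longrightarrow> x \<in> \<Delta> \<Longrightarrow> \<phi> (g x) = \<rho> g (\<phi> x)"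
  using phi_act[of x g] by (simp add: natural_act_def)

lemma phi_eq_iff: "x \<in> \<Delta> \<Longrightarrow> y \<in> \<Delta> \<Longrightarrow> \<phi> x = \<phi> y \<longleftrightarrow> x = y"
  using inj_phi by (auto dest: inj_onD)

lemma transitive:
  assumes "x \<in> \<Delta>" "y \<in> \<Delta>"
  obtains g where "g \<in> K" "g x = y"
  using primitive_K assms unfolding primitive_on_def transitive_on_def by blast

text \<open>A transitive group on at least two points moves every point, and \<open>\<phi>\<close> is injective. In
  particular no point is represented by \<open>0\<close>.\<close>

lemma phi_not_fixed:
  assumes x: "x \<in> \<Delta>"
  shows "\<phi> x \<notin> fixed_vectors"
proof
  assume fixed: "\<phi> x \<in> fixed_vectors"
  obtain y where y: "y \<in> \<Delta>" "x \<noteq> y"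
    using nontrivial by blast
  obtain g where "g \<in> K" "g x = y"
    using transitive x y by blast
  then have "\<phi> y = \<phi> x"
    using fixed phi_perm[of g x] x by (simp add: fixed_vectors_def)
  then show False
    using phi_eq_iff x y by blast
qed

lemma fixed_diff:
  assumes "\<phi> x - \<phi> y \<in> fixed_vectors" and "g \<in> K" "x \<in> \<Delta>" "y \<in> \<Delta>"
  shows "\<phi> (g x) - \<phi> (g y) = \<phi> x - \<phi> y"
  using assms rho_diff[of g "\<phi> x" "\<phi> y"] by (simp add: phi_perm phi_mem fixed_vectors_def)

text \<open>When \<open>K\<close> fixes all differences of points, it preserves the cosets of every additive subgroup
  of vectors. Points in the same coset of the subgroup generated by \<open>b\<close> therefore form a block; as
  soon as one block has two points, primitivity makes it everything.\<close>

lemma translates_of_cyclic_subgroup: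
  assumes fixed: "\<And>x y. x \<in> \<Delta> \<Longrightarrow> y \<in> \<Delta> \<Longrightarrow> \<phi> x - \<phi> y \<in> fixed_vectors"
    and xy: "x \<in> \<Delta>" "y \<in> \<Delta>" "x \<noteq> y" "\<phi> x - \<phi> y \<in> range (\<lambda>n::int. s (of_int n) b)"
    and uv: "u \<in> \<Delta>" "v \<in> \<Delta>"
  shows "\<phi> u - \<phi> v \<in> range (\<lambda>n::int. s (of_int n) b)"
proof -
  let ?R = "range (\<lambda>n::int. s (of_int n) b)"
  let ?f = "\<lambda>x. {w. w - \<phi> x \<in> ?R}"
  have R0: "0 \<in> ?R"
    by (intro image_eqI[of _ _ 0]) simp_all
  have R_add: "v + w \<in> ?R" if vw: "v \<in> ?R" "w \<in> ?R" for v w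
  proof -
    obtain m n :: int where "v = s (of_int m) b" "w = s (of_int n) b"
      using vw by blast
    then show ?thesis
      by (intro image_eqI[of _ _ "m + n"]) (simp_all add: scale_left_distrib)
  qed
  have R_minus: "- v \<in> ?R" if v: "v \<in> ?R" for v
  proof -
    obtain m :: int where "v = s (of_int m) b"
      using v by blast
    then show ?thesis
      by (intro image_eqI[of _ _ "- m"]) simp_all
  qed
  have f_eq: "?f x = ?f y \<longleftrightarrow> \<phi> x - \<phi> y \<in> ?R" for x y
  proof
    assume "?f x = ?f y"
    moreover have "\<phi> x \<in> ?f x"
      using R0 by simp
    ultimately show "\<phi> x - \<phi> y \<in> ?R"
      by blast
  next
    assume r: "\<phi> x - \<phi> y \<in> ?R"
    have "w - \<phi> x \<in> ?R \<longleftrightarrow> w - \<phi> y \<in> ?R" for w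
      using R_add[OF _ r, of "w - \<phi> x"] R_add[OF _ R_minus[OF r], of "w - \<phi> y"] by auto
    then show "?f x = ?f y"
      by blast
  qed
  have "inj_on ?f \<Delta> \<or> (\<forall>x\<in>\<Delta>. \<forall>y\<in>\<Delta>. ?f x = ?f y)"
  proof (rule primitive_on_fibres[OF subgroup_K primitive_K])
    fix g x y assume g: "g \<in> K" and xy: "x \<in> \<Delta>" "y \<in> \<Delta>" "?f x = ?f y"
    show "?f (g x) = ?f (g y)"
      using xy(3) unfolding f_eq fixed_diff[OF fixed[OF xy(1,2)] g xy(1,2)] .
  qed
  then show ?thesis
    using xy uv unfolding f_eq inj_on_def by blast
qed

text \<open>Let \<open>a\<close> be the difference of two points. All points lie in one coset of the group generated
  by \<open>a\<close>. In characteristic \<open>0\<close> they would also lie in one coset of the group generated by \<open>2 a\<close>,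
  which does not contain \<open>a\<close>. So \<open>a\<close> has additive order \<open>char F\<close>, and the points are exactly one
  coset of the group that it generates.\<close>

lemma translations_imp_regular_char:
  assumes fixed: "\<And>x y. x \<in> \<Delta> \<Longrightarrow> y \<in> \<Delta> \<Longrightarrow> \<phi> x - \<phi> y \<in> fixed_vectors"
  shows "regular_on \<Delta> K \<and> finite \<Delta> \<and> card \<Delta> = CHAR('f)"
proof -
  have diff: "\<phi> (g x) - \<phi> (g y) = \<phi> x - \<phi> y" if "g \<in> K" "x \<in> \<Delta>" "y \<in> \<Delta>" for g x y
    using fixed_diff[OF fixed[OF that(2,3)] that] .
  have regular: "regular_on \<Delta> K"
    unfolding regular_on_def
  proof (intro conjI ballI)
    show "transitive_on \<Delta> K"
      using primitive_K by (simp add: primitive_on_def)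
    fix x assume x: "x \<in> \<Delta>"
    have "g = id" if g: "g \<in> K" "g x = x" for g
    proof
      fix y
      show "g y = id y"
      proof (cases "y \<in> \<Delta>")
        case True
        then have "\<phi> (g y) = \<phi> y"
          using diff[OF g(1) True x] g(2) by simp
        then show ?thesis
          using phi_eq_iff perm_mem[OF g(1)] True by simp
      qed (use permutes_not_in[OF perm[OF g(1)]] in simp)
    qed
    then show "{g \<in> K. g x = x} = {id}"
      using subgroup.one_closed[OF subgroup_K] by auto
  qed
  obtain x\<^sub>0 x\<^sub>1 where x: "x\<^sub>0 \<in> \<Delta>" "x\<^sub>1 \<in> \<Delta>" "x\<^sub>0 \<noteq> x\<^sub>1"
    using nontrivial by blast
  obtain g where g: "g \<in> K" "g x\<^sub>0 = x\<^sub>1"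
    using transitive x by blast
  define a where "a = \<phi> x\<^sub>1 - \<phi> x\<^sub>0"
  have a: "a \<noteq> 0"
    using x phi_eq_iff by (simp add: a_def)
  have pow_mem: "(g ^^ n) x\<^sub>0 \<in> \<Delta>" for n
    using perm_mem[OF funpow_mem_subgroup_Sym[OF subgroup_K g(1)]] x(1) .
  have pow: "\<phi> ((g ^^ n) x\<^sub>0) = \<phi> x\<^sub>0 + s (of_nat n) a" for n
  proof (induction n)
    case (Suc n)
    have "\<phi> (g ((g ^^ n) x\<^sub>0)) - \<phi> (g x\<^sub>0) = \<phi> ((g ^^ n) x\<^sub>0) - \<phi> x\<^sub>0"
      by (rule diff[OF g(1) pow_mem x(1)])
    then show ?case
      using Suc g(2) by (simp add: a_def algebra_simps)
  qed simp
  have CHAR: "CHAR('f) \<noteq> 0"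
  proof
    assume CHAR0: "CHAR('f) = 0"
    have "(of_nat 2 :: 'f) \<noteq> 0"
      unfolding of_nat_eq_0_iff_char_dvd CHAR0 by simp
    then have "\<phi> ((g ^^ 2) x\<^sub>0) \<noteq> \<phi> x\<^sub>0"
      using a pow[of 2] by (auto simp: numeral_2_eq_2)
    moreover have "\<phi> ((g ^^ 2) x\<^sub>0) - \<phi> x\<^sub>0 \<in> range (\<lambda>n::int. s (of_int n) (s 2 a))"
      using pow[of 2] by (intro image_eqI[of _ _ 1]) simp_all
    ultimately have "\<phi> x\<^sub>1 - \<phi> x\<^sub>0 \<in> range (\<lambda>n::int. s (of_int n) (s 2 a))"
      using translates_of_cyclic_subgroup[OF fixed, of "(g ^^ 2) x\<^sub>0" x\<^sub>0] pow_mem x by metis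
    then obtain n :: int where "a = s (of_int n) (s 2 a)"
      unfolding a_def by blast
    then have "s (of_int (2 * n - 1)) a = 0"
      by (simp add: scale_left_diff_distrib mult.commute)
    then have "of_int (2 * n - 1) = (0 :: 'f)"
      using a unfolding scale_eq_0_iff by blast
    then have "2 * n - 1 = 0"
      unfolding of_int_eq_0_iff_char_dvd CHAR0 by simp
    then show False
      by presburger
  qed
  let ?p = "CHAR('f)"
  have "\<phi> ` \<Delta> = (\<lambda>n. \<phi> x\<^sub>0 + s (of_nat n) a) ` {..<?p}" (is "_ = ?t ` _")
  proof
    show "?t ` {..<?p} \<subseteq> \<phi> ` \<Delta>"
      using pow_mem by (auto simp flip: pow)
    show "\<phi> ` \<Delta> \<subseteq> ?t ` {..<?p}"
    proof
      fix v assume "v \<in> \<phi> ` \<Delta>"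
      then obtain y where y: "y \<in> \<Delta>" "v = \<phi> y"
        by blast
      have "\<phi> x\<^sub>1 - \<phi> x\<^sub>0 \<in> range (\<lambda>n::int. s (of_int n) a)"
        unfolding a_def by (intro image_eqI[of _ _ 1]) simp_all
      then have "\<phi> y - \<phi> x\<^sub>0 \<in> range (\<lambda>n::int. s (of_int n) a)"
        using translates_of_cyclic_subgroup[OF fixed, of x\<^sub>1 x\<^sub>0] x y(1) by metis
      then obtain n :: int where n: "\<phi> y - \<phi> x\<^sub>0 = s (of_int n) a"
        by blast
      have "of_int (n - n mod int ?p) = (0 :: 'f)"
        unfolding of_int_eq_0_iff_char_dvd by (metis dvd_minus_mod)
      then have "of_int n = (of_int (n mod int ?p) :: 'f)"
        by simp
      also have "\<dots> = of_nat (nat (n mod int ?p))"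
        using CHAR by simp
      finally have "v = ?t (nat (n mod int ?p))"
        using n y(2) by (metis add_diff_cancel_left' diff_add_cancel add.commute)
      moreover have "nat (n mod int ?p) < ?p"
        using CHAR by (simp add: nat_less_iff)
      ultimately show "v \<in> ?t ` {..<?p}"
        by blast
    qed
  qed
  moreover have "inj_on ?t {..<?p}"
  proof (rule inj_onI)
    fix m n assume mn: "m \<in> {..<?p}" "n \<in> {..<?p}" "?t m = ?t n"
    then have "of_nat m = (of_nat n :: 'f)"
      using a by simp
    then have "of_int (int m - int n) = (0 :: 'f)"
      by simp
    then have "int ?p dvd int m - int n"
      by (simp only: of_int_eq_0_iff_char_dvd)
    then have "int m mod int ?p = int n mod int ?p"
      by (simp only: mod_eq_dvd_iff)
    then show "m = n"
      using mn by simp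
  qed
  ultimately have "bij_betw ?t {..<?p} (\<phi> ` \<Delta>)"
    by (simp add: bij_betw_def)
  then have "finite (\<phi> ` \<Delta>)" "card (\<phi> ` \<Delta>) = ?p"
    using bij_betw_finite bij_betw_same_card by fastforce+
  then have "finite \<Delta>" "card \<Delta> = ?p"
    using inj_phi by (simp_all add: finite_image_iff card_image)
  with regular show ?thesis
    by blast
qed

text \<open>If the points were all on one line, a generator \<open>g\<close> of \<open>K\<close> would multiply this line by a scalar
  \<open>c\<close> with \<open>c ^ p = 1\<close>. In characteristic \<open>p\<close> this says \<open>(c - 1) ^ p = 0\<close>, so that \<open>g\<close> would fix
  a point.\<close>

lemma independent_pair:
  assumes reg: "regular_on \<Delta> K" and p: "card \<Delta> = CHAR('f)" "prime CHAR('f)"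
  obtains x y where "x \<in> \<Delta>" "y \<in> \<Delta>" "\<phi> x \<noteq> \<phi> y" "independent {\<phi> x, \<phi> y}"
proof -
  obtain x y where xy: "x \<in> \<Delta>" "y \<in> \<Delta>" "x \<noteq> y"
    using nontrivial by blast
  obtain g where g: "g \<in> K" "g x = y"
    using transitive xy by blast
  have nz: "\<phi> x \<noteq> 0"
    using phi_not_fixed[OF xy(1)] subspace_0[OF subspace_fixed_vectors] by auto
  have "\<phi> y \<notin> span {\<phi> x}"
  proof
    assume "\<phi> y \<in> span {\<phi> x}"
    then obtain c where c: "\<phi> y = s c (\<phi> x)"
      by (auto simp: span_singleton)
    have "\<phi> ((g ^^ n) x) = s (c ^ n) (\<phi> x)" for n
    proof (induction n)
      case (Suc n)
      have "\<phi> ((g ^^ Suc n) x) = \<rho> g (s (c ^ n) (\<phi> x))"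
        using perm_mem[OF funpow_mem_subgroup_Sym[OF subgroup_K g(1)] xy(1)] phi_perm[OF g(1)] Suc
        by simp
      also have "\<dots> = s (c ^ n) (\<phi> (g x))"
        using g(1) xy(1) phi_mem by (simp add: rho_scale phi_perm)
      finally show ?case
        using c g(2) by (simp add: mult.commute)
    qed simp
    moreover have "g ^^ CHAR('f) = id"
    proof (rule regular_prime_cyclic(1)[OF subgroup_K reg p g(1)])
      show "g \<noteq> id"
        using g(2) xy(3) by auto
    qed
    ultimately have "s (c ^ CHAR('f) - 1) (\<phi> x) = 0"
      by (metis eq_id_iff eq_iff_diff_eq_0 scale_left_diff_distrib scale_one)
    then have "c ^ CHAR('f) = 1"
      using nz by simp
    moreover have "c ^ CHAR('f) = (c - 1) ^ CHAR('f) + 1 ^ CHAR('f)"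
      using freshmans_dream[OF p(2) refl, of "c - 1" 1] by simp
    ultimately have "c = 1"
      by simp
    then show False
      using c xy phi_eq_iff by simp
  qed
  moreover have "independent {\<phi> x}"
    using nz by simp
  ultimately have "independent {\<phi> x, \<phi> y}"
    using independent_insertI[of "\<phi> y" "{\<phi> x}"] by (simp add: insert_commute)
  moreover have "\<phi> x \<noteq> \<phi> y"
    using xy phi_eq_iff by simp
  ultimately show ?thesis
    using that xy by blast
qed

text \<open>The points cannot all be equal modulo \<open>S\<close>, since \<open>K\<close> would then act on them by translations.
  They are therefore distinct modulo \<open>S\<close>, and represent \<open>\<Delta>\<close> in the quotient by \<open>S\<close>, where a basis
  \<open>D\<close> can be chosen among them. The complement \<open>span D\<close> of \<open>S\<close> with the projected action serves as
  the quotient.\<close>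

lemma LinDim_modulo_fixed_subspace:
  assumes S: "subspace S" "S \<subseteq> fixed_vectors"
    and exception: "\<not> (regular_on \<Delta> K \<and> finite \<Delta> \<and> card \<Delta> = CHAR('f))"
  obtains D where "D \<subseteq> \<phi> ` \<Delta>" "LinDim TYPE('f) (perm_group \<Delta> K) \<Delta> natural_act \<le>o |D|"
    "\<And>d. d \<in> D \<Longrightarrow> d \<notin> span (S \<union> (D - {d}))"
proof -
  obtain E where E: "E \<subseteq> S" "independent E" "S \<subseteq> span E"
    using maximal_independent_subset by blast
  have span_E: "span E = S"
    using E S span_minimal by blast
  obtain B where B: "E \<subseteq> B" "B \<subseteq> E \<union> \<phi> ` \<Delta>" "independent B" "E \<union> \<phi> ` \<Delta> \<subseteq> span B"
    using maximal_independent_subset_extend[of E "E \<union> \<phi> ` \<Delta>"] E(2) by blast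
  define D where "D = B - E"
  have D: "D \<subseteq> \<phi> ` \<Delta>" "B = E \<union> D" "E \<inter> D = {}"
    using B by (auto simp: D_def)
  have SV: "S \<subseteq> V" and S_fixed: "\<And>g v. g \<in> K \<Longrightarrow> v \<in> S \<Longrightarrow> \<rho> g v = v"
    using S by (auto simp: fixed_vectors_def)
  have D_indep: "d \<notin> span (S \<union> (D - {d}))" if "d \<in> D" for d
  proof
    assume "d \<in> span (S \<union> (D - {d}))"
    moreover have "S \<union> (D - {d}) \<subseteq> span (B - {d})"
      using that D span_E span_mono[of E "B - {d}"] span_superset[of "B - {d}"] by blast
    ultimately have "d \<in> span (B - {d})"
      using span_minimal[OF _ subspace_span] by blast
    then show False
      using B(3) D that dependent_def by blast
  qed
  interpret pair: vector_space_pair s s ..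
  \<comment> \<open>The projection onto \<open>span D\<close> along \<open>S\<close>. The operators \<open>\<pi> \<circ> \<rho> g\<close> compose correctly (\<open>rho_cong\<close>)
    because \<open>\<rho> g\<close> fixes \<open>S\<close>.\<close>
  define \<pi> where "\<pi> = pair.construct B (\<lambda>b. if b \<in> E then 0 else b)"
  have linear: "Vector_Spaces.linear s s \<pi>"
    unfolding \<pi>_def by (rule pair.linear_construct[OF B(3)])
  interpret \<pi>: Vector_Spaces.linear s s \<pi>
    by (rule linear)
  have \<pi>_B: "\<pi> b = (if b \<in> E then 0 else b)" if "b \<in> B" for b
    unfolding \<pi>_def by (rule pair.construct_basis[OF B(3) that])
  have \<pi>_S: "\<pi> v = 0" if "v \<in> S" for v
  proof (rule \<pi>.eq_0_on_span)
    show "v \<in> span E"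
      using that span_E by simp
    show "\<pi> b = 0" if "b \<in> E" for b
      using \<pi>_B B(1) that by auto
  qed
  have \<pi>_D: "\<pi> v = v" if "v \<in> span D" for v
  proof (rule pair.linear_eq_on[OF linear _ that])
    show "Vector_Spaces.linear s s (\<lambda>v. v)"
      by (rule linear_ident)
    show "\<pi> b = b" if "b \<in> D" for b
      using \<pi>_B that D by auto
  qed
  have split: "\<pi> v \<in> span D \<and> v - \<pi> v \<in> S" if "v \<in> span B" for v
  proof -
    obtain x y where xy: "v = x + y" "x \<in> S" "y \<in> span D"
      using \<open>v \<in> span B\<close> unfolding D(2) span_Un span_E by blast
    then show ?thesis
      by (simp add: \<pi>.add \<pi>_S \<pi>_D)
  qed
  have span_B_V: "span B \<subseteq> V"
    using B(2) E(1) SV phi_mem by (intro span_minimal[OF _ subspace_V]) blast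
  have span_D_V: "span D \<subseteq> V"
    using span_B_V span_mono[of D B] D(2) by blast
  have phi_B: "\<phi> x \<in> span B" if "x \<in> \<Delta>" for x
    using B(4) that by blast
  have rho_B: "\<rho> g v \<in> span B" if g: "g \<in> K" and v: "v \<in> span B" for g v
  proof -
    have "subspace {v \<in> V. \<rho> g v \<in> span B}"
      using subspace_V g unfolding subspace_def
      by (auto simp: rho_zero rho_add rho_scale intro: span_add span_scale span_zero)
    moreover have "E \<union> \<phi> ` \<Delta> \<subseteq> {v \<in> V. \<rho> g v \<in> span B}"
    proof (rule Un_least)
      show "E \<subseteq> {v \<in> V. \<rho> g v \<in> span B}"
        using E(1) SV S_fixed[OF g] B(4) by force
      show "\<phi> ` \<Delta> \<subseteq> {v \<in> V. \<rho> g v \<in> span B}"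
        using phi_mem phi_B perm_mem[OF g] by (auto simp: phi_perm[OF g, symmetric])
    qed
    ultimately show ?thesis
      using span_minimal v B(2) by blast
  qed
  have rho_cong: "\<pi> (\<rho> g (\<pi> v)) = \<pi> (\<rho> g v)" if g: "g \<in> K" and v: "v \<in> span B" for g v
  proof -
    have "\<pi> v \<in> V" "v - \<pi> v \<in> S"
      using split[OF v] span_D_V by auto
    then have "\<rho> g v = \<rho> g (\<pi> v) + (v - \<pi> v)"
      using rho_add[of g "\<pi> v" "v - \<pi> v"] g SV S_fixed by auto
    then show ?thesis
      using \<open>v - \<pi> v \<in> S\<close> by (simp add: \<pi>.add \<pi>_S)
  qed
  have kernel: "\<phi> x - \<phi> y \<in> S" if "x \<in> \<Delta>" "y \<in> \<Delta>" "\<pi> (\<phi> x) = \<pi> (\<phi> y)" for x y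
  proof -
    have "\<phi> x - \<phi> y \<in> span B"
      using that phi_B span_diff by blast
    then show ?thesis
      using split[of "\<phi> x - \<phi> y"] that by (simp add: \<pi>.diff)
  qed
  have "inj_on (\<pi> \<circ> \<phi>) \<Delta> \<or> (\<forall>x\<in>\<Delta>. \<forall>y\<in>\<Delta>. (\<pi> \<circ> \<phi>) x = (\<pi> \<circ> \<phi>) y)"
  proof (rule primitive_on_fibres[OF subgroup_K primitive_K])
    fix g x y assume g: "g \<in> K" and xy: "x \<in> \<Delta>" "y \<in> \<Delta>" "(\<pi> \<circ> \<phi>) x = (\<pi> \<circ> \<phi>) y"
    have "\<phi> (g x) - \<phi> (g y) = \<phi> x - \<phi> y"
      using kernel[of x y] xy g S_fixed[of g "\<phi> x - \<phi> y"] rho_diff[of g "\<phi> x" "\<phi> y"]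
      by (simp add: phi_perm phi_mem)
    then show "(\<pi> \<circ> \<phi>) (g x) = (\<pi> \<circ> \<phi>) (g y)"
      using xy by (metis \<pi>.diff comp_apply eq_iff_diff_eq_0)
  qed
  moreover have "\<not> (\<forall>x\<in>\<Delta>. \<forall>y\<in>\<Delta>. (\<pi> \<circ> \<phi>) x = (\<pi> \<circ> \<phi>) y)"
  proof
    assume const: "\<forall>x\<in>\<Delta>. \<forall>y\<in>\<Delta>. (\<pi> \<circ> \<phi>) x = (\<pi> \<circ> \<phi>) y"
    have "\<phi> x - \<phi> y \<in> fixed_vectors" if "x \<in> \<Delta>" "y \<in> \<Delta>" for x y
    proof -
      have "\<pi> (\<phi> x) = \<pi> (\<phi> y)"
        using bspec[OF bspec[OF const that(1)] that(2)] by (simp only: comp_apply)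
      then show ?thesis
        using kernel[OF that] S(2) by blast
    qed
    then show False
      using translations_imp_regular_char exception by blast
  qed
  ultimately have inj: "inj_on (\<pi> \<circ> \<phi>) \<Delta>"
    by blast
  have "representation_of s (perm_group \<Delta> K) \<Delta> natural_act (span D)
      (\<lambda>g v. if v \<in> span D then \<pi> (\<rho> g v) else v) (\<pi> \<circ> \<phi>)"
  proof (rule representation_ofI[OF G.group_axioms vector_space_axioms subspace_span])
    have sub: "span D \<subseteq> span B"
      using span_mono[of D B] D(2) by blast
    show "\<pi> (\<rho> g v) \<in> span D" if "g \<in> carrier (perm_group \<Delta> K)" "v \<in> span D" for g v
      using that rho_B split sub by auto
    show "\<pi> (\<rho> \<one>\<^bsub>perm_group \<Delta> K\<^esub> v) = v" if "v \<in> span D" for v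
      unfolding rho_one by (rule \<pi>_D[OF that])
    show "\<pi> (\<rho> (g \<otimes>\<^bsub>perm_group \<Delta> K\<^esub> h) v) = \<pi> (\<rho> h (\<pi> (\<rho> g v)))"
      if "g \<in> carrier (perm_group \<Delta> K)" "h \<in> carrier (perm_group \<Delta> K)" "v \<in> span D" for g h v
      unfolding rho_mult[OF that(1,2)] using that rho_cong rho_B sub by auto
    show "\<pi> (\<rho> g (v + w)) = \<pi> (\<rho> g v) + \<pi> (\<rho> g w)"
      if "g \<in> carrier (perm_group \<Delta> K)" "v \<in> span D" "w \<in> span D" for g v w
      using that(1) rho_add[OF that(1), of v w] subsetD[OF span_D_V that(2)]
        subsetD[OF span_D_V that(3)] by (simp add: \<pi>.add)
    show "\<pi> (\<rho> g (s c v)) = s c (\<pi> (\<rho> g v))"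
      if "g \<in> carrier (perm_group \<Delta> K)" "v \<in> span D" for g c v
      using rho_scale[OF that(1), of v c] subsetD[OF span_D_V that(2)] by (simp add: \<pi>.scale)
    show "\<pi> \<circ> \<phi> \<in> \<Delta> \<rightarrow> span D"
      using phi_B split by auto
    show "inj_on (\<pi> \<circ> \<phi>) \<Delta>"
      by (rule inj)
    show "(\<pi> \<circ> \<phi>) (natural_act x g) = \<pi> (\<rho> g ((\<pi> \<circ> \<phi>) x))"
      if "x \<in> \<Delta>" "g \<in> carrier (perm_group \<Delta> K)" for x g
      using that rho_cong[of g "\<phi> x"] phi_B phi_act[of x g] by simp
  qed
  then have "LinDim TYPE('f) (perm_group \<Delta> K) \<Delta> natural_act \<le>o |D|"
    by (rule LinDim_le_spanning[OF G.group_axioms action]) simp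
  then show ?thesis
    using that D(1) D_indep by blast
qed

end

section \<open>Lower bounds for wreath products\<close>

definition coord_embed :: "'i set \<Rightarrow> 'i \<Rightarrow> ('d \<Rightarrow> 'd) \<Rightarrow> ('i \<Rightarrow> 'd \<Rightarrow> 'd) \<times> ('i \<Rightarrow> 'i)" where
  "coord_embed I i k = ((\<lambda>j\<in>I. if j = i then k else id), id)"

lemma imprimitive_act_coord_embed:
  "j \<in> I \<Longrightarrow> imprimitive_act (\<delta>, j) (coord_embed I i k) = (if j = i then k \<delta> else \<delta>, j)"
  by (simp add: imprimitive_act_def coord_embed_def)

lemma coord_embed_hom:
  assumes K: "subgroup K (Sym \<Delta>)" and L: "subgroup L (Sym I)"
  shows "coord_embed I i \<in> hom (perm_group \<Delta> K) (wreath (perm_group \<Delta> K) I L)"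
proof (rule homI)
  fix k k' assume "k \<in> carrier (perm_group \<Delta> K)" "k' \<in> carrier (perm_group \<Delta> K)"
  then show "coord_embed I i (k \<otimes>\<^bsub>perm_group \<Delta> K\<^esub> k') =
      coord_embed I i k \<otimes>\<^bsub>wreath (perm_group \<Delta> K) I L\<^esub> coord_embed I i k'"
    by (auto simp: coord_embed_def mult_wreath permutes_id)
qed (use subgroup.one_closed[OF K] subgroup.one_closed[OF L] in
    \<open>auto simp: coord_embed_def carrier_wreath\<close>)

lemma card_of_finite_ordIso: "finite A \<Longrightarrow> finite B \<Longrightarrow> card A = card B \<Longrightarrow> |A| =o |B|"
  using finite_same_card_bij card_of_ordIso by blast

locale wreath_rep =
  action_rep s "wreath (perm_group \<Delta> K) I L" "\<Delta> \<times> I" imprimitive_act V \<rho> \<phi>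
  for s :: "'f::field \<Rightarrow> 'v::ab_group_add \<Rightarrow> 'v" and \<Delta> :: "'d set" and K
    and I :: "'i set" and L V \<rho> \<phi> +
  assumes subgroup_K: "subgroup K (Sym \<Delta>)" and primitive_K: "primitive_on \<Delta> K"
    and nontrivial: "\<exists>x\<in>\<Delta>. \<exists>y\<in>\<Delta>. x \<noteq> y" and subgroup_L: "subgroup L (Sym I)"
begin

lemma fibre_rep:
  assumes i: "i \<in> I"
  shows "primitive_rep s \<Delta> K V (\<rho> \<circ> coord_embed I i) (\<phi> \<circ> (\<lambda>\<delta>. (\<delta>, i)))"
proof -
  have "action_rep s (perm_group \<Delta> K) \<Delta> natural_act V (\<rho> \<circ> coord_embed I i) (\<phi> \<circ> (\<lambda>\<delta>. (\<delta>, i)))"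
    using i by (intro pullback group_perm_group right_action_natural_act coord_embed_hom
        subgroup_K subgroup_L) (auto simp: inj_on_def imprimitive_act_coord_embed natural_act_def)
  then show ?thesis
    using subgroup_K primitive_K nontrivial by (simp add: primitive_rep_def primitive_rep_axioms_def)
qed

definition other_fibres :: "'i \<Rightarrow> 'v set" where
  "other_fibres i = span (\<phi> ` (\<Delta> \<times> (I - {i})))"

lemma other_fibres_fixed:
  assumes i: "i \<in> I"
  shows "other_fibres i \<subseteq> action_rep.fixed_vectors (perm_group \<Delta> K) V (\<rho> \<circ> coord_embed I i)"
proof -
  interpret F: primitive_rep s \<Delta> K V "\<rho> \<circ> coord_embed I i" "\<phi> \<circ> (\<lambda>\<delta>. (\<delta>, i))"
    by (rule fibre_rep[OF i])
  have "\<phi> (\<delta>, j) \<in> F.fixed_vectors" if "\<delta> \<in> \<Delta>" "j \<in> I" "j \<noteq> i" for \<delta> j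
  proof -
    have "\<rho> (coord_embed I i k) (\<phi> (\<delta>, j)) = \<phi> (\<delta>, j)" if k: "k \<in> K" for k
      using phi_act[of "(\<delta>, j)" "coord_embed I i k"] coord_embed_hom[OF subgroup_K subgroup_L, of i]
        k \<open>\<delta> \<in> \<Delta>\<close> \<open>j \<in> I\<close> \<open>j \<noteq> i\<close>
      by (auto simp: hom_def imprimitive_act_coord_embed Pi_iff)
    then show ?thesis
      using phi_mem that by (auto simp: F.fixed_vectors_def)
  qed
  then show ?thesis
    unfolding other_fibres_def by (intro span_minimal F.subspace_fixed_vectors) auto
qed

lemma phi_not_in_other_fibres:
  assumes "i \<in> I" "\<delta> \<in> \<Delta>"
  shows "\<phi> (\<delta>, i) \<notin> other_fibres i"
proof -
  interpret F: primitive_rep s \<Delta> K V "\<rho> \<circ> coord_embed I i" "\<phi> \<circ> (\<lambda>\<delta>. (\<delta>, i))"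
    by (rule fibre_rep[OF assms(1)])
  show ?thesis
    using F.phi_not_fixed[OF assms(2)] other_fibres_fixed[OF assms(1)] by auto
qed

text \<open>Modulo the span of the other fibres, each fibre spans a space of dimension at least
  \<open>LinDim K\<close>. Bases of these quotients lift to points of the fibres, and these points are jointly
  independent: a relation between them that involves a point of the fibre \<open>i\<close> would give a relation
  in the quotient by the other fibres.\<close>

theorem card_mult_LinDim_le:
  assumes exception: "\<not> (regular_on \<Delta> K \<and> finite \<Delta> \<and> card \<Delta> = CHAR('f))"
    and B: "V \<subseteq> span B"
  shows "|I| *c LinDim TYPE('f) (perm_group \<Delta> K) \<Delta> natural_act \<le>o |B|"
proof -
  let ?r = "LinDim TYPE('f) (perm_group \<Delta> K) \<Delta> natural_act"
  have "\<exists>D. D \<subseteq> (\<lambda>\<delta>. \<phi> (\<delta>, i)) ` \<Delta> \<and> ?r \<le>o |D| \<and>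
      (\<forall>d\<in>D. d \<notin> span (other_fibres i \<union> (D - {d})))" if i: "i \<in> I" for i
  proof -
    interpret F: primitive_rep s \<Delta> K V "\<rho> \<circ> coord_embed I i" "\<phi> \<circ> (\<lambda>\<delta>. (\<delta>, i))"
      by (rule fibre_rep[OF i])
    have "subspace (other_fibres i)"
      by (simp add: other_fibres_def)
    then obtain E where "E \<subseteq> (\<phi> \<circ> (\<lambda>\<delta>. (\<delta>, i))) ` \<Delta>" "?r \<le>o |E|"
      "\<And>d. d \<in> E \<Longrightarrow> d \<notin> span (other_fibres i \<union> (E - {d}))"
      using F.LinDim_modulo_fixed_subspace[OF _ other_fibres_fixed[OF i] exception] by metis
    then show ?thesis
      by (intro exI[of _ E]) (auto simp: image_comp)
  qed
  then obtain D where D: "\<And>i. i \<in> I \<Longrightarrow> D i \<subseteq> (\<lambda>\<delta>. \<phi> (\<delta>, i)) ` \<Delta>"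
    and r: "\<And>i. i \<in> I \<Longrightarrow> ?r \<le>o |D i|"
    and D_indep: "\<And>i d. i \<in> I \<Longrightarrow> d \<in> D i \<Longrightarrow> d \<notin> span (other_fibres i \<union> (D i - {d}))"
    by metis
  have D_other: "D j \<subseteq> other_fibres i" if "i \<in> I" "j \<in> I" "i \<noteq> j" for i j
    unfolding other_fibres_def using D[OF that(2)] that by (auto intro!: span_base)
  have disjoint: "D i \<inter> D j = {}" if "i \<in> I" "j \<in> I" "i \<noteq> j" for i j
    using D_other[OF that] D_indep[OF that(1)] by (auto intro: span_base)
  let ?D = "\<Union>i\<in>I. D i"
  have "independent ?D"
    unfolding dependent_def
  proof clarify
    fix i d assume i: "i \<in> I" and d: "d \<in> D i" and "d \<in> span (?D - {d})"
    moreover have "?D - {d} \<subseteq> other_fibres i \<union> (D i - {d})"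
      using D_other[OF i] by blast
    ultimately show False
      using D_indep[OF i d] span_mono by blast
  qed
  moreover have "?D \<subseteq> V"
    using D phi_mem by blast
  ultimately have D_B: "|?D| \<le>o |B|"
    using B by (intro independent_card_of_le) auto
  have "|I| *c ?r = |I \<times> Field ?r|"
    by (simp add: cprod_def Field_card_of)
  also have "|I \<times> Field ?r| \<le>o |SIGMA i : I. D i|"
  proof (rule card_of_Sigma_mono1)
    have "|Field ?r| =o ?r"
      using LinDim_minimum(1)[OF rep_dims_nonempty[OF group_perm_group[OF subgroup_K]
            right_action_natural_act[OF subgroup_K]]]
      by (intro card_of_Field_ordIso rep_dims_Card_order)
    then show "\<forall>i\<in>I. |Field ?r| \<le>o |D i|"
      by (intro ballI ordIso_ordLeq_trans[OF _ r])
  qed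
  also have "|SIGMA i : I. D i| \<le>o |?D|"
  proof -
    have "inj_on snd (SIGMA i : I. D i)"
    proof (rule inj_onI)
      fix a b assume "a \<in> (SIGMA i : I. D i)" "b \<in> (SIGMA i : I. D i)" "snd a = snd b"
      then obtain i j d where *: "a = (i, d)" "b = (j, d)" "i \<in> I" "j \<in> I" "d \<in> D i \<inter> D j"
        by (metis IntI SigmaE snd_conv)
      then have "i = j"
        using disjoint[of i j] by blast
      then show "a = b"
        using * by simp
    qed
    moreover have "snd ` (SIGMA i : I. D i) \<subseteq> ?D"
      by auto
    ultimately show ?thesis
      using card_of_ordLeq[THEN iffD1] by blast
  qed
  also note D_B
  finally show ?thesis .
qed

text \<open>Start from two independent points of one fibre and add one point from each other fibre in turn:
  no point is in the span of the points of other fibres.\<close>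

theorem Suc_card_le:
  assumes reg: "regular_on \<Delta> K" and p: "card \<Delta> = CHAR('f)" "prime CHAR('f)"
    and I: "finite I" "I \<noteq> {}" and B: "V \<subseteq> span B"
  shows "|{..card I}| \<le>o |B|"
proof -
  obtain i where i: "i \<in> I"
    using I by blast
  interpret F: primitive_rep s \<Delta> K V "\<rho> \<circ> coord_embed I i" "\<phi> \<circ> (\<lambda>\<delta>. (\<delta>, i))"
    by (rule fibre_rep[OF i])
  obtain x y where xy: "x \<in> \<Delta>" "y \<in> \<Delta>" "\<phi> (x, i) \<noteq> \<phi> (y, i)" "independent {\<phi> (x, i), \<phi> (y, i)}"
    using F.independent_pair[OF reg p] by auto
  let ?T = "\<lambda>J. {\<phi> (x, i), \<phi> (y, i)} \<union> (\<lambda>j. \<phi> (x, j)) ` J"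
  have T: "independent (?T J) \<and> card (?T J) = card J + 2" if "finite J" "J \<subseteq> I - {i}" for J
    using that
  proof (induction J)
    case empty
    then show ?case
      using xy by simp
  next
    case (insert j J)
    have "?T J \<subseteq> \<phi> ` (\<Delta> \<times> (I - {j}))"
      using insert.prems insert.hyps i xy by auto
    then have notin: "\<phi> (x, j) \<notin> span (?T J)"
      using phi_not_in_other_fibres[of j x] insert.prems xy span_mono
      unfolding other_fibres_def by blast
    moreover have "\<phi> (x, j) \<notin> ?T J"
      using notin span_base by (rule contrapos_nn)
    moreover have "?T (insert j J) = insert (\<phi> (x, j)) (?T J)"
      by auto
    ultimately show ?case
      using insert by (simp add: independent_insertI)
  qed
  let ?T' = "?T (I - {i})"
  have "independent ?T'" "card ?T' = card I + 1"
    using T[of "I - {i}"] card_Suc_Diff1[OF I(1) i] I(1) by auto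
  moreover have "?T' \<subseteq> V"
    using xy i phi_mem by auto
  ultimately have "|?T'| \<le>o |B|"
    using B by (intro independent_card_of_le) auto
  moreover have "|{..card I}| =o |?T'|"
    using \<open>card ?T' = card I + 1\<close> I by (intro card_of_finite_ordIso) auto
  ultimately show ?thesis
    using ordIso_ordLeq_trans by blast
qed

end

section \<open>Upper bounds for wreath products\<close>

lemma carrier_wreath_decompose:
  assumes g: "g \<in> carrier (wreath (perm_group \<Delta> K) I L)" and L: "subgroup L (Sym I)"
  shows "\<exists>h \<sigma>. g = (h, \<sigma>) \<and> (\<forall>i\<in>I. h i \<in> K) \<and> \<sigma> permutes I"
proof -
  obtain h \<sigma> where "g = (h, \<sigma>)" "h \<in> (\<Pi>\<^sub>E i\<in>I. K)" "\<sigma> \<in> L"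
    using g by (auto simp: carrier_wreath)
  then show ?thesis
    using subgroup.subset[OF L] by auto
qed

lemma sum_fun_apply: "(\<Sum>i\<in>A. f i) x = (\<Sum>i\<in>A. f i x)"
  by (induction A rule: infinite_finite_induct) auto

text \<open>The representation is the direct sum of copies of a minimal representation \<open>V\<close> of \<open>K\<close>, one for
  each index, with \<open>(\<delta>, i)\<close> sent to \<open>\<phi> \<delta>\<close> in the \<open>i\<close>-th summand. Points of different fibres stay
  distinct because \<open>\<phi>\<close> does not vanish.\<close>

theorem LinDim_wreath_le_card_mult:
  fixes \<Delta> :: "'d set" and I :: "'i set"
  assumes K: "subgroup K (Sym \<Delta>)" and transitive: "transitive_on \<Delta> K"
    and nontrivial: "\<exists>x\<in>\<Delta>. \<exists>y\<in>\<Delta>. x \<noteq> y" and L: "subgroup L (Sym I)" and I: "finite I"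
  shows "LinDim TYPE('f::field) (wreath (perm_group \<Delta> K) I L) (\<Delta> \<times> I) imprimitive_act
    \<le>o |I| *c LinDim TYPE('f) (perm_group \<Delta> K) \<Delta> natural_act"
proof -
  let ?W = "wreath (perm_group \<Delta> K) I L"
  have gK: "group (perm_group \<Delta> K)" and actK: "right_action (perm_group \<Delta> K) \<Delta> natural_act"
    using K by (auto intro: group_perm_group right_action_natural_act)
  obtain V \<rho> \<phi> B where
    "representation_of (fun_scale :: 'f \<Rightarrow> ('d \<Rightarrow> 'f) \<Rightarrow> _) (perm_group \<Delta> K) \<Delta> natural_act V \<rho> \<phi>"
    and B: "basis_of fun_scale B V"
    and dim: "LinDim TYPE('f) (perm_group \<Delta> K) \<Delta> natural_act = |B|"
    using LinDim_attained[OF gK actK] by blast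
  then interpret K: action_rep "fun_scale :: 'f \<Rightarrow> ('d \<Rightarrow> 'f) \<Rightarrow> _" "perm_group \<Delta> K" \<Delta> natural_act V \<rho> \<phi>
    using gK actK vector_space_fun_scale by (simp add: action_rep_def action_rep_axioms_def)
  have perm: "k permutes \<Delta>" if "k \<in> K" for k
    using subgroup.subset[OF K] that by auto
  have phi_nz: "\<phi> \<delta> \<noteq> 0" if d: "\<delta> \<in> \<Delta>" for \<delta>
  proof
    assume 0: "\<phi> \<delta> = 0"
    obtain \<delta>' where d': "\<delta>' \<in> \<Delta>" "\<delta>' \<noteq> \<delta>"
      using nontrivial by blast
    then obtain k where k: "k \<in> K" "k \<delta> = \<delta>'"
      using transitive d unfolding transitive_on_def by blast
    then have "\<phi> \<delta>' = \<phi> \<delta>"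
      using K.phi_act[OF d, of k] K.rho_zero[of k] 0 by (simp add: natural_act_def)
    then show False
      using K.inj_phi d d' by (auto dest: inj_onD)
  qed
  define s :: "'f \<Rightarrow> ('i \<Rightarrow> 'd \<Rightarrow> 'f) \<Rightarrow> 'i \<Rightarrow> 'd \<Rightarrow> 'f" where "s c v = (\<lambda>i. fun_scale c (v i))" for c v
  interpret S: vector_space s
    by unfold_locales (auto simp: s_def fun_scale_def fun_eq_iff algebra_simps)
  define \<iota> :: "'i \<Rightarrow> ('d \<Rightarrow> 'f) \<Rightarrow> 'i \<Rightarrow> 'd \<Rightarrow> 'f" where "\<iota> i b = (\<lambda>j. if j = i then b else 0)" for i b
  define V' where "V' = {v :: 'i \<Rightarrow> 'd \<Rightarrow> 'f. (\<forall>i\<in>I. v i \<in> V) \<and> (\<forall>i. i \<notin> I \<longrightarrow> v i = 0)}"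
  define R where "R = (\<lambda>(h, \<sigma>) (v :: 'i \<Rightarrow> 'd \<Rightarrow> 'f) j.
    if j \<in> I then \<rho> (h (inv_into UNIV \<sigma> j)) (v (inv_into UNIV \<sigma> j)) else 0)"
  have inv_mem: "inv_into UNIV \<sigma> j \<in> I" if "\<sigma> permutes I" "j \<in> I" for \<sigma> j
    using that permutes_in_image[OF permutes_inv[OF that(1)]] by simp
  have "representation_of s ?W (\<Delta> \<times> I) imprimitive_act V'
      (\<lambda>g v. if v \<in> V' then R g v else v) (\<lambda>(\<delta>, i). \<iota> i (\<phi> \<delta>))"
  proof (rule representation_ofI[OF group_wreath[OF gK L] S.vector_space_axioms])
    show "S.subspace V'"
      using K.subspace_V unfolding V'_def S.subspace_def K.subspace_def s_def
      by (auto simp: fun_scale_def fun_eq_iff)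
    show "R g v \<in> V'" if mem: "g \<in> carrier ?W" "v \<in> V'" for g v
    proof -
      obtain h \<sigma> where "g = (h, \<sigma>)" "\<And>i. i \<in> I \<Longrightarrow> h i \<in> K" "\<sigma> permutes I"
        using carrier_wreath_decompose[OF mem(1) L] by blast
      then show ?thesis
        using mem(2) inv_mem K.rho_mem by (simp add: R_def V'_def)
    qed
    show "R \<one>\<^bsub>?W\<^esub> v = v" if "v \<in> V'" for v
    proof
      fix j
      show "R \<one>\<^bsub>?W\<^esub> v j = v j"
        using that K.rho_one by (auto simp: R_def V'_def one_wreath inv_id)
    qed
    show "R (g \<otimes>\<^bsub>?W\<^esub> g') v = R g' (R g v)"
      if mem: "g \<in> carrier ?W" "g' \<in> carrier ?W" "v \<in> V'" for g g' v
    proof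
      fix j
      obtain h \<sigma> where g: "g = (h, \<sigma>)" "\<And>i. i \<in> I \<Longrightarrow> h i \<in> K" "\<sigma> permutes I"
        using carrier_wreath_decompose[OF mem(1) L] by blast
      obtain h' \<sigma>' where g': "g' = (h', \<sigma>')" "\<And>i. i \<in> I \<Longrightarrow> h' i \<in> K" "\<sigma>' permutes I"
        using carrier_wreath_decompose[OF mem(2) L] by blast
      show "R (g \<otimes>\<^bsub>?W\<^esub> g') v j = R g' (R g v) j"
      proof (cases "j \<in> I")
        case True
        let ?j' = "inv_into UNIV \<sigma>' j" let ?j = "inv_into UNIV \<sigma> ?j'"
        have j: "?j' \<in> I" "?j \<in> I" "\<sigma> ?j = ?j'" "inv_into UNIV (\<sigma>' \<circ> \<sigma>) j = ?j"
          using True inv_mem g(3) g'(3) permutes_inverses(1)[OF g(3)]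
          by (simp_all add: o_inv_distrib permutes_bij)
        have "R (g \<otimes>\<^bsub>?W\<^esub> g') v j = \<rho> (h ?j \<otimes>\<^bsub>perm_group \<Delta> K\<^esub> h' ?j') (v ?j)"
          using True j by (simp add: R_def g(1) g'(1) mult_wreath[OF g(3)])
        also have "\<dots> = \<rho> (h' ?j') (\<rho> (h ?j) (v ?j))"
          using K.rho_mult[of "h ?j" "h' ?j'"] g(2)[OF j(2)] g'(2)[OF j(1)] by simp
        also have "\<dots> = R g' (R g v) j"
          using True j by (simp add: R_def g(1) g'(1))
        finally show ?thesis .
      qed (simp add: R_def g(1) g'(1) mult_wreath[OF g(3)])
    qed
    show "R g (v + w) = R g v + R g w" if mem: "g \<in> carrier ?W" "v \<in> V'" "w \<in> V'" for g v w
    proof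
      fix j
      obtain h \<sigma> where "g = (h, \<sigma>)" "\<And>i. i \<in> I \<Longrightarrow> h i \<in> K" "\<sigma> permutes I"
        using carrier_wreath_decompose[OF mem(1) L] by blast
      then show "R g (v + w) j = (R g v + R g w) j"
        using mem(2,3) inv_mem by (simp add: R_def V'_def K.rho_add)
    qed
    show "R g (s c v) = s c (R g v)" if mem: "g \<in> carrier ?W" "v \<in> V'" for g c v
    proof
      fix j
      obtain h \<sigma> where "g = (h, \<sigma>)" "\<And>i. i \<in> I \<Longrightarrow> h i \<in> K" "\<sigma> permutes I"
        using carrier_wreath_decompose[OF mem(1) L] by blast
      then show "R g (s c v) j = s c (R g v) j"
        using mem(2) inv_mem by (simp add: R_def V'_def s_def K.rho_scale)
    qed
    show "(\<lambda>(\<delta>, i). \<iota> i (\<phi> \<delta>)) \<in> \<Delta> \<times> I \<rightarrow> V'"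
      using K.phi_mem K.subspace_0[OF K.subspace_V] by (auto simp: V'_def \<iota>_def)
    show "inj_on (\<lambda>(\<delta>, i). \<iota> i (\<phi> \<delta>)) (\<Delta> \<times> I)"
    proof (rule inj_onI, clarify)
      fix \<delta> i \<delta>' i' assume d: "\<delta> \<in> \<Delta>" "\<delta>' \<in> \<Delta>" and eq: "\<iota> i (\<phi> \<delta>) = \<iota> i' (\<phi> \<delta>')"
      have "i = i'"
        using fun_cong[OF eq, of i] phi_nz[OF d(1)] by (auto simp: \<iota>_def split: if_splits)
      moreover from this have "\<phi> \<delta> = \<phi> \<delta>'"
        using fun_cong[OF eq, of i] by (simp add: \<iota>_def)
      ultimately show "\<delta> = \<delta>' \<and> i = i'"
        using K.inj_phi d by (auto dest: inj_onD)
    qed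
    show "(\<lambda>(\<delta>, i). \<iota> i (\<phi> \<delta>)) (imprimitive_act \<omega> g) = R g ((\<lambda>(\<delta>, i). \<iota> i (\<phi> \<delta>)) \<omega>)"
      if mem: "\<omega> \<in> \<Delta> \<times> I" "g \<in> carrier ?W" for \<omega> g
    proof
      fix j
      obtain \<delta> i where w: "\<omega> = (\<delta>, i)" "\<delta> \<in> \<Delta>" "i \<in> I"
        using mem(1) by blast
      obtain h \<sigma> where g: "g = (h, \<sigma>)" "\<And>i. i \<in> I \<Longrightarrow> h i \<in> K" "\<sigma> permutes I"
        using carrier_wreath_decompose[OF mem(2) L] by blast
      have j: "inv_into UNIV \<sigma> j = i \<longleftrightarrow> j = \<sigma> i"
        using permutes_inverses[OF g(3)] by metis
      have "\<rho> (h (inv_into UNIV \<sigma> j)) 0 = 0" if "j \<in> I"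
        using K.rho_zero g(2) inv_mem[OF g(3) that] by simp
      moreover have "\<rho> (h i) (\<phi> \<delta>) = \<phi> (h i \<delta>)"
        using K.phi_act[OF w(2), of "h i"] g(2)[OF w(3)] by (simp add: natural_act_def)
      moreover have "\<sigma> i \<in> I"
        using w(3) permutes_in_image[OF g(3)] by simp
      ultimately show "(\<lambda>(\<delta>, i). \<iota> i (\<phi> \<delta>)) (imprimitive_act \<omega> g) j =
          R g ((\<lambda>(\<delta>, i). \<iota> i (\<phi> \<delta>)) \<omega>) j"
        by (cases "j = \<sigma> i") (auto simp: w(1) g(1) imprimitive_act_def R_def \<iota>_def j permutes_inverses(2)[OF g(3)])
    qed
  qed
  moreover have "V' \<subseteq> S.span ((\<lambda>(i, b). \<iota> i b) ` (I \<times> B))"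
  proof
    let ?A = "(\<lambda>(i, b). \<iota> i b) ` (I \<times> B)"
    fix v assume v: "v \<in> V'"
    have \<iota>_span: "\<iota> i b \<in> S.span ?A" if "i \<in> I" "b \<in> V" for i b
    proof -
      have *: "\<iota> i 0 = 0" "\<iota> i (x + y) = \<iota> i x + \<iota> i y" "\<iota> i (fun_scale c x) = s c (\<iota> i x)" for x y c
        by (auto simp: \<iota>_def s_def fun_eq_iff fun_scale_def)
      have "K.subspace {b. \<iota> i b \<in> S.span ?A}"
        unfolding K.subspace_def by (auto simp: * intro: S.span_add S.span_scale S.span_zero)
      moreover have "B \<subseteq> {b. \<iota> i b \<in> S.span ?A}"
        using that(1) by (auto intro!: S.span_base)
      ultimately have "K.span B \<subseteq> {b. \<iota> i b \<in> S.span ?A}"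
        by (intro K.span_minimal)
      then show ?thesis
        using that(2) B by (auto simp: basis_of_def)
    qed
    have "v = (\<Sum>i\<in>I. \<iota> i (v i))"
    proof
      fix j
      have "(\<Sum>i\<in>I. \<iota> i (v i)) j = (\<Sum>i\<in>I. if i = j then v i else 0)"
        by (simp add: sum_fun_apply \<iota>_def if_distrib eq_commute cong: if_cong)
      also have "\<dots> = v j"
        using v I by (simp add: sum.delta V'_def)
      finally show "v j = (\<Sum>i\<in>I. \<iota> i (v i)) j" ..
    qed
    also have "\<dots> \<in> S.span ?A"
      using v \<iota>_span by (intro S.span_sum) (auto simp: V'_def)
    finally show "v \<in> S.span ?A" .
  qed
  ultimately have "LinDim TYPE('f) ?W (\<Delta> \<times> I) imprimitive_act \<le>o |(\<lambda>(i, b). \<iota> i b) ` (I \<times> B)|"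
    by (rule LinDim_le_spanning[OF group_wreath[OF gK L] right_action_imprimitive_act[OF K L]])
  also have "|(\<lambda>(i, b). \<iota> i b) ` (I \<times> B)| \<le>o |I \<times> B|"
    by (rule card_of_image)
  finally show ?thesis
    by (simp add: dim cprod_def Field_card_of)
qed

text \<open>A generator \<open>g\<close> and a base point \<open>x\<close> turn the action into addition in the prime field: the
  coordinate \<open>c\<close> of \<open>(g ^^ n) x\<close> and the translation length \<open>t\<close> of \<open>g ^^ n\<close> are both \<open>n\<close>. They are
  well defined since \<open>n\<close> matters only modulo the characteristic on either side.\<close>

lemma regular_prime_additive_coordinates:
  fixes \<Delta> :: "'d set"
  assumes K: "subgroup K (Sym \<Delta>)" and reg: "regular_on \<Delta> K"
    and p: "card \<Delta> = CHAR('f::field)" "prime CHAR('f::field)"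
  obtains c :: "'d \<Rightarrow> 'f::field" and t :: "('d \<Rightarrow> 'd) \<Rightarrow> 'f"
  where "inj_on c \<Delta>" "t id = 0" "\<And>g h. g \<in> K \<Longrightarrow> h \<in> K \<Longrightarrow> t (h \<circ> g) = t g + t h"
    "\<And>g x. g \<in> K \<Longrightarrow> x \<in> \<Delta> \<Longrightarrow> c (g x) = c x + t g"
proof -
  have fin: "finite \<Delta>" and two: "card \<Delta> \<ge> 2"
    using p prime_ge_2_nat by (auto intro: card_ge_0_finite simp: prime_gt_0_nat)
  obtain x where x: "x \<in> \<Delta>"
    using two by fastforce
  have "\<not> (\<forall>a\<in>\<Delta>. \<forall>b\<in>\<Delta>. a = b)"
    using two card_le_Suc0_iff_eq[OF fin] by simp
  then obtain y where y: "y \<in> \<Delta>" "y \<noteq> x"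
    by metis
  obtain g where g: "g \<in> K" "g x = y"
    using reg x y unfolding regular_on_def transitive_on_def by blast
  then have "g \<noteq> id"
    using y by auto
  note cyclic = regular_prime_cyclic[OF K reg p g(1) this]
  have of_nat_eq: "of_nat m = (of_nat n :: 'f) \<longleftrightarrow> g ^^ m = g ^^ n" for m n
  proof -
    have "of_nat m = (of_nat n :: 'f) \<longleftrightarrow> of_int (int m - int n) = (0 :: 'f)"
      by simp
    also have "\<dots> \<longleftrightarrow> int m mod int CHAR('f) = int n mod int CHAR('f)"
      by (simp only: of_int_eq_0_iff_char_dvd mod_eq_dvd_iff)
    also have "\<dots> \<longleftrightarrow> m mod CHAR('f) = n mod CHAR('f)"
      by (metis of_nat_eq_iff zmod_int)
    finally show ?thesis
      by (simp only: cyclic(3))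
  qed
  have fixed_point: "(g ^^ m) x = (g ^^ n) x \<longleftrightarrow> g ^^ m = g ^^ n" for m n
    using regular_on_eqI[OF K reg _ _ x] funpow_mem_subgroup_Sym[OF K g(1)] by metis
  have orbit: "\<exists>n. z = (g ^^ n) x" if "z \<in> \<Delta>" for z
    using reg x that cyclic(2) unfolding regular_on_def transitive_on_def by fast
  define c where "c z = (of_nat (SOME n. z = (g ^^ n) x) :: 'f)" for z
  have c: "c ((g ^^ n) x) = of_nat n" for n
    unfolding c_def of_nat_eq by (rule someI2[of _ n]) (simp_all add: fixed_point)
  define t where "t h = c (h x)" for h
  have t: "t (g ^^ n) = of_nat n" for n
    by (simp add: t_def c)
  have K_pow: "\<exists>n. h = g ^^ n" if "h \<in> K" for h
    using that cyclic(2) by blast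
  have c_t: "c (h z) = c z + t h" if "h \<in> K" "z \<in> \<Delta>" for h z
  proof -
    obtain m n where "h = g ^^ m" "z = (g ^^ n) x"
      using K_pow orbit \<open>h \<in> K\<close> \<open>z \<in> \<Delta>\<close> by blast
    then show ?thesis
      using c[of "m + n"] by (simp add: c t funpow_add)
  qed
  show ?thesis
  proof
    show "inj_on c \<Delta>"
    proof (rule inj_onI)
      fix u v assume uv: "u \<in> \<Delta>" "v \<in> \<Delta>" "c u = c v"
      obtain m n where "u = (g ^^ m) x" "v = (g ^^ n) x"
        using orbit uv by meson
      then show "u = v"
        using uv(3) by (simp add: c of_nat_eq)
    qed
    show "t id = 0"
      using t[of 0] by simp
    show "t (h \<circ> h') = t h' + t h" if "h' \<in> K" "h \<in> K" for h' h
    proof -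
      have "h' x \<in> \<Delta>"
        using that(1) subgroup.subset[OF K] x permutes_in_image by fastforce
      then show ?thesis
        using c_t[OF that(2)] by (simp add: t_def)
    qed
  qed (rule c_t)
qed

text \<open>On the space with basis \<open>e\<^sub>0\<close> and \<open>e\<^sub>i\<close> for \<open>i \<in> I\<close>, let \<open>(h, \<sigma>)\<close> fix \<open>e\<^sub>0\<close> and send \<open>e\<^sub>i\<close> to
  \<open>e\<^bsub>\<sigma> i\<^esub> + t (h i) e\<^sub>0\<close>. Then \<open>(\<delta>, i) \<mapsto> e\<^sub>i + c \<delta> e\<^sub>0\<close> is equivariant because
  \<open>c (h i \<delta>) = c \<delta> + t (h i)\<close>. The index \<open>0\<close> is \<open>None\<close> below.\<close>

theorem LinDim_wreath_le_Suc_card: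
  fixes \<Delta> :: "'d set" and I :: "'i set"
  assumes K: "subgroup K (Sym \<Delta>)" and reg: "regular_on \<Delta> K"
    and p: "card \<Delta> = CHAR('f::field)" "prime CHAR('f)"
    and L: "subgroup L (Sym I)" and I: "finite I"
  shows "LinDim TYPE('f) (wreath (perm_group \<Delta> K) I L) (\<Delta> \<times> I) imprimitive_act \<le>o |{..card I}|"
proof -
  let ?W = "wreath (perm_group \<Delta> K) I L"
  have gK: "group (perm_group \<Delta> K)"
    by (rule group_perm_group[OF K])
  obtain c :: "'d \<Rightarrow> 'f" and t :: "('d \<Rightarrow> 'd) \<Rightarrow> 'f" where c: "inj_on c \<Delta>" and t_id: "t id = 0"
    and t_mult: "\<And>g h. g \<in> K \<Longrightarrow> h \<in> K \<Longrightarrow> t (h \<circ> g) = t g + t h"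
    and c_t: "\<And>g x. g \<in> K \<Longrightarrow> x \<in> \<Delta> \<Longrightarrow> c (g x) = c x + t g"
    using regular_prime_additive_coordinates[OF K reg p] by metis
  interpret S: vector_space "fun_scale :: 'f \<Rightarrow> ('i option \<Rightarrow> 'f) \<Rightarrow> _"
    by (rule vector_space_fun_scale)
  let ?J = "insert None (Some ` I)"
  define V where "V = {v :: 'i option \<Rightarrow> 'f. \<forall>j. j \<notin> ?J \<longrightarrow> v j = 0}"
  define R where "R = (\<lambda>(h, \<sigma>) (v :: 'i option \<Rightarrow> 'f) j. case j of
      None \<Rightarrow> v None + (\<Sum>i\<in>I. t (h i) * v (Some i))
    | Some i \<Rightarrow> if i \<in> I then v (Some (inv_into UNIV \<sigma> i)) else 0)"
  define \<phi> where "\<phi> = (\<lambda>(\<delta>, i :: 'i). \<lambda>j. case j of None \<Rightarrow> c \<delta> | Some i' \<Rightarrow> if i' = i then 1 else (0 :: 'f))"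
  have inv_mem: "inv_into UNIV \<sigma> j \<in> I" if "\<sigma> permutes I" "j \<in> I" for \<sigma> j
    using that permutes_in_image[OF permutes_inv[OF that(1)]] by simp
  have "representation_of fun_scale ?W (\<Delta> \<times> I) imprimitive_act V
      (\<lambda>g v. if v \<in> V then R g v else v) \<phi>"
  proof (rule representation_ofI[OF group_wreath[OF gK L] vector_space_fun_scale])
    show "S.subspace V"
      unfolding V_def S.subspace_def by (auto simp: fun_scale_def)
    show "R g v \<in> V" if mem: "g \<in> carrier ?W" "v \<in> V" for g v
      by (auto simp: R_def V_def split: prod.splits option.splits)
    show "R \<one>\<^bsub>?W\<^esub> v = v" if "v \<in> V" for v
    proof
      fix j
      show "R \<one>\<^bsub>?W\<^esub> v j = v j"
        using that by (cases j) (auto simp: R_def V_def one_wreath t_id)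
    qed
    show "R (g \<otimes>\<^bsub>?W\<^esub> g') v = R g' (R g v)"
      if mem: "g \<in> carrier ?W" "g' \<in> carrier ?W" "v \<in> V" for g g' v
    proof
      fix j
      obtain h \<sigma> where g: "g = (h, \<sigma>)" "\<And>i. i \<in> I \<Longrightarrow> h i \<in> K" "\<sigma> permutes I"
        using carrier_wreath_decompose[OF mem(1) L] by blast
      obtain h' \<sigma>' where g': "g' = (h', \<sigma>')" "\<And>i. i \<in> I \<Longrightarrow> h' i \<in> K" "\<sigma>' permutes I"
        using carrier_wreath_decompose[OF mem(2) L] by blast
      have \<sigma>_mem: "\<sigma> i \<in> I" if "i \<in> I" for i
        using that permutes_in_image[OF g(3)] by simp
      show "R (g \<otimes>\<^bsub>?W\<^esub> g') v j = R g' (R g v) j"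
      proof (cases j)
        case None
        have "R (g \<otimes>\<^bsub>?W\<^esub> g') v j = v None + (\<Sum>i\<in>I. t (h' (\<sigma> i) \<circ> h i) * v (Some i))"
          using None by (simp add: R_def g(1) g'(1) mult_wreath[OF g(3)])
        also have "(\<Sum>i\<in>I. t (h' (\<sigma> i) \<circ> h i) * v (Some i)) =
            (\<Sum>i\<in>I. t (h i) * v (Some i)) + (\<Sum>i\<in>I. t (h' (\<sigma> i)) * v (Some i))"
          by (simp add: t_mult g(2) g'(2) \<sigma>_mem distrib_right sum.distrib)
        also have "(\<Sum>i\<in>I. t (h' (\<sigma> i)) * v (Some i)) =
            (\<Sum>i\<in>I. t (h' i) * v (Some (inv_into UNIV \<sigma> i)))"
          using permutes_inverses[OF g(3)]
          by (subst sum.permute[OF g(3), of "\<lambda>i. t (h' i) * v (Some (inv_into UNIV \<sigma> i))"]) simp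
        finally show ?thesis
          using None by (simp add: R_def g(1) g'(1) add.assoc)
      next
        case (Some i)
        have "inv_into UNIV (\<sigma>' \<circ> \<sigma>) i = inv_into UNIV \<sigma> (inv_into UNIV \<sigma>' i)"
          using g(3) g'(3) by (simp add: o_inv_distrib permutes_bij)
        then show ?thesis
          using Some inv_mem[OF g'(3)] by (simp add: R_def g(1) g'(1) mult_wreath[OF g(3)])
      qed
    qed
    show "R g (v + w) = R g v + R g w" for g v w
      by (auto simp: R_def fun_eq_iff distrib_left sum.distrib split: prod.splits option.splits)
    show "R g (fun_scale a v) = fun_scale a (R g v)" for g a v
      by (auto simp: R_def fun_eq_iff fun_scale_def distrib_left sum_distrib_left mult.left_commute
          split: prod.splits option.splits)
    show "\<phi> \<in> \<Delta> \<times> I \<rightarrow> V"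
      by (auto simp: \<phi>_def V_def split: option.splits)
    show "inj_on \<phi> (\<Delta> \<times> I)"
    proof (rule inj_onI, clarify)
      fix \<delta> i \<delta>' i' assume d: "\<delta> \<in> \<Delta>" "\<delta>' \<in> \<Delta>" and eq: "\<phi> (\<delta>, i) = \<phi> (\<delta>', i')"
      have "i = i'"
        using fun_cong[OF eq, of "Some i"] by (simp add: \<phi>_def split: if_splits)
      moreover have "c \<delta> = c \<delta>'"
        using fun_cong[OF eq, of None] by (simp add: \<phi>_def)
      ultimately show "\<delta> = \<delta>' \<and> i = i'"
        using c d by (auto dest: inj_onD)
    qed
    show "\<phi> (imprimitive_act \<omega> g) = R g (\<phi> \<omega>)" if mem: "\<omega> \<in> \<Delta> \<times> I" "g \<in> carrier ?W" for \<omega> g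
    proof
      fix j
      obtain \<delta> i where w: "\<omega> = (\<delta>, i)" "\<delta> \<in> \<Delta>" "i \<in> I"
        using mem(1) by blast
      obtain h \<sigma> where g: "g = (h, \<sigma>)" "\<And>i. i \<in> I \<Longrightarrow> h i \<in> K" "\<sigma> permutes I"
        using carrier_wreath_decompose[OF mem(2) L] by blast
      show "\<phi> (imprimitive_act \<omega> g) j = R g (\<phi> \<omega>) j"
      proof (cases j)
        case None
        have "(\<Sum>i'\<in>I. t (h i') * (if i' = i then 1 else 0)) = t (h i)"
          using I w(3) by (simp add: if_distrib cong: if_cong)
        then show ?thesis
          using None c_t[OF g(2)[OF w(3)] w(2)]
          by (simp add: w(1) g(1) imprimitive_act_def R_def \<phi>_def)
      next
        case (Some i')
        have "inv_into UNIV \<sigma> i' = i \<longleftrightarrow> i' = \<sigma> i"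
          using permutes_inverses[OF g(3)] by metis
        moreover have "\<sigma> i \<in> I"
          using w(3) permutes_in_image[OF g(3)] by simp
        ultimately show ?thesis
          using Some by (auto simp: w(1) g(1) imprimitive_act_def R_def \<phi>_def)
      qed
    qed
  qed
  moreover have "V \<subseteq> S.span (point_vec ` ?J)"
  proof
    fix v assume v: "v \<in> V"
    have "v = (\<Sum>j\<in>?J. fun_scale (v j) (point_vec j))"
    proof
      fix k
      have "(\<Sum>j\<in>?J. fun_scale (v j) (point_vec j)) k = (\<Sum>j\<in>?J. if k = j then v j else 0)"
        by (simp add: sum_fun_apply fun_scale_def point_vec_def if_distrib cong: if_cong)
      also have "\<dots> = v k"
        using v I by (subst sum.delta') (auto simp: V_def)
      finally show "v k = (\<Sum>j\<in>?J. fun_scale (v j) (point_vec j)) k" ..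
    qed
    also have "\<dots> \<in> S.span (point_vec ` ?J)"
      by (intro S.span_sum S.span_scale S.span_base) auto
    finally show "v \<in> S.span (point_vec ` ?J)" .
  qed
  ultimately have "LinDim TYPE('f) ?W (\<Delta> \<times> I) imprimitive_act \<le>o |point_vec ` ?J :: ('i option \<Rightarrow> 'f) set|"
    by (rule LinDim_le_spanning[OF group_wreath[OF gK L] right_action_imprimitive_act[OF K L]])
  also have "|point_vec ` ?J :: ('i option \<Rightarrow> 'f) set| \<le>o |?J|"
    by (rule card_of_image)
  also have "|?J| =o |{..card I}|"
  proof (rule card_of_finite_ordIso)
    show "card ?J = card {..card I}"
      using I by (subst card_insert_disjoint) (auto simp: card_image)
  qed (use I in auto)
  finally show ?thesis .
qed

section \<open>The dimension formula\<close>

theorem theorem1p2: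
  fixes \<Delta> :: "'d set" and K :: "('d \<Rightarrow> 'd) set"
    and l :: nat and L :: "(nat \<Rightarrow> nat) set"
  assumes "subgroup K (Sym \<Delta>)" and "primitive_on \<Delta> K"
    and "infinite \<Delta> \<or> card \<Delta> \<ge> 2"
    and "l \<ge> 1" and "subgroup L (Sym {1..l})"
  defines "G \<equiv> wreath (perm_group \<Delta> K) {1..l} L"
    and "\<Omega> \<equiv> \<Delta> \<times> {1..l}"
  shows "(regular_on \<Delta> K \<and> finite \<Delta> \<and> card \<Delta> = CHAR('f::field) \<longrightarrow>
           LinDim TYPE('f) G \<Omega> imprimitive_act =o |{1..l + 1}| ) \<and>
         (\<not> (regular_on \<Delta> K \<and> finite \<Delta> \<and> card \<Delta> = CHAR('f)) \<longrightarrow>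
           LinDim TYPE('f) G \<Omega> imprimitive_act =o
             |{1..l}| *c LinDim TYPE('f) (perm_group \<Delta> K) \<Delta> natural_act)"
proof -
  note K = assms(1) and L = assms(5)
  have two: "\<exists>x\<in>\<Delta>. \<exists>y\<in>\<Delta>. x \<noteq> y"
  proof (rule ccontr)
    assume "\<not> ?thesis"
    then have "\<exists>x. \<Delta> \<subseteq> {x}"
      by blast
    then obtain x where x: "\<Delta> \<subseteq> {x}" ..
    have "finite \<Delta>" "card \<Delta> \<le> 1"
      using finite_subset[OF x] card_mono[OF _ x] by simp_all
    then show False
      using assms(3) by simp
  qed
  have G: "group G" "right_action G \<Omega> imprimitive_act"
    unfolding G_def \<Omega>_def
    by (intro group_wreath group_perm_group right_action_imprimitive_act K L)+
  obtain V \<rho> \<phi> B where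
    rep: "representation_of (fun_scale :: 'f \<Rightarrow> ('d \<times> nat \<Rightarrow> 'f) \<Rightarrow> _) G \<Omega> imprimitive_act V \<rho> \<phi>"
    and B: "basis_of fun_scale B V" and dim: "LinDim TYPE('f) G \<Omega> imprimitive_act = |B|"
    using LinDim_attained[OF G] by blast
  interpret wreath_rep "fun_scale :: 'f \<Rightarrow> ('d \<times> nat \<Rightarrow> 'f) \<Rightarrow> _" \<Delta> K "{1..l}" L V \<rho> \<phi>
    unfolding wreath_rep_def action_rep_def wreath_rep_axioms_def action_rep_axioms_def
    using rep G two vector_space_fun_scale assms(1,2,5) unfolding G_def \<Omega>_def by blast
  have span_B: "V \<subseteq> span B"
    using B by (simp add: basis_of_def)
  show ?thesis
  proof (intro conjI impI)
    assume exception: "regular_on \<Delta> K \<and> finite \<Delta> \<and> card \<Delta> = CHAR('f)"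
    then have "CHAR('f) > 0"
      using assms(3) by simp
    then have p: "prime CHAR('f)"
      by (rule prime_CHAR_semidom)
    have "|{..l}| \<le>o |B|"
      using Suc_card_le[OF _ _ p _ _ span_B] exception assms(4) by simp
    moreover have "|B| \<le>o |{..l}|"
      using LinDim_wreath_le_Suc_card[OF K _ _ p L] exception
      by (simp flip: dim add: G_def \<Omega>_def)
    moreover have "|{..l}| =o |{1..l + 1}|"
      by (rule card_of_finite_ordIso) auto
    ultimately show "LinDim TYPE('f) G \<Omega> imprimitive_act =o |{1..l + 1}|"
      unfolding dim using ordIso_iff_ordLeq ordIso_transitive by blast
  next
    assume exception: "\<not> (regular_on \<Delta> K \<and> finite \<Delta> \<and> card \<Delta> = CHAR('f))"
    have "transitive_on \<Delta> K"
      using assms(2) by (simp add: primitive_on_def)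
    then have "LinDim TYPE('f) G \<Omega> imprimitive_act \<le>o
        |{1..l}| *c LinDim TYPE('f) (perm_group \<Delta> K) \<Delta> natural_act"
      unfolding G_def \<Omega>_def by (rule LinDim_wreath_le_card_mult[OF K _ two L]) simp
    moreover have "|{1..l}| *c LinDim TYPE('f) (perm_group \<Delta> K) \<Delta> natural_act \<le>o
        LinDim TYPE('f) G \<Omega> imprimitive_act"
      unfolding dim by (rule card_mult_LinDim_le[OF exception span_B])
    ultimately show "LinDim TYPE('f) G \<Omega> imprimitive_act =o
        |{1..l}| *c LinDim TYPE('f) (perm_group \<Delta> K) \<Delta> natural_act"
      by (simp add: ordIso_iff_ordLeq)
  qed
qed

end
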